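(* From a formula $\varphi\in\mathrm{FO}[\exists^{(t,p)}\bar x,\exists^{\ge c}\bar x,\exists^{=c}\bar x]$ one can construct, in time doubly exponential in $|\varphi|$, an equivalent formula $\gamma\in\mathrm{FO}[\exists^{(q,p)}x]$. Moreover $\textsc{Coeff}(\gamma)\subseteq\textsc{Coeff}(\varphi)$, $\textsc{Const}(\gamma)\subseteq\textsc{Const}(\varphi)$, $\textsc{Mod}(\gamma)\subseteq\textsc{Mod}(\varphi)$, and the quantifier depth $\mathrm{qd}(\gamma)$ is bounded by a polynomial in $|\varphi|$.
   Context: Formulas are interpreted over $\mathbb{Z}$ with all integer constants, $+$, $<$ and the relations $\equiv_k$ ($k\ge2$; $m\equiv_k n$ iff $k\mid m-n$). Terms are built from variables and integer constants by addition and multiplication by integers; every term is equivalent to a unique normal form $a_1x_{i_1}+\dots+a_nx_{i_n}+c$ with $i_1<\dots<i_n$, all $a_j\neq0$; the $a_j$ are its coefficients and $c$ its constant. Atomic formulas are $s<t$ and $s\equiv_k t$ ($k\ge1$). Formulas of $\mathrm{FO}[\exists^{(t,p)}\bar x,\exists^{\ge c}\bar x,\exists^{=c}\bar x]$ are built from atomic formulas using $\neg,\land,\lor,\to,\leftrightarrow$, $\exists y$, and quantifiers $\exists^{(t,p)}(y_1,\dots,y_\ell)$ ($t$ a term, $p\ge2$), $\exists^{\ge c}(y_1,\dots,y_\ell)$, $\exists^{=c}(y_1,\dots,y_\ell)$ ($c\ge1$), with $\ell\ge1$ and distinct $y_i$. With $W$ the set of tuples $\bar a\in\mathbb{Z}^\ell$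 such that $\varphi$ holds when $y_i$ is set to $a_i$ (other variables as given by the assignment $f$): $\exists^{(t,p)}\bar y\,\varphi$ holds iff $W$ is finite and $|W|\equiv f(t)\pmod p$; $\exists^{\ge c}\bar y\,\varphi$ iff $|W|\ge c$; $\exists^{=c}\bar y\,\varphi$ iff $|W|=c$. The fragment $\mathrm{FO}[\exists^{(q,p)}x]$ allows only atomic formulas, the Boolean connectives, $\exists y$, and modulo-counting quantifiers $\exists^{(q,p)}y$ over a single variable with residue a natural number constant $q$. Two formulas are equivalent if they have the same truth value under every assignment. $|\varphi|$ is the size of $\varphi$ with integers in binary. $\textsc{Coeff}(\varphi)$ is the set consisting of $0,\pm1,\pm2$ and all $\pm a$ with $a$ a coefficient of the normal form of $s_1-s_2$ for an atomic subformula $s_1<s_2$ of $\varphi$; $\textsc{Const}(\varphi)$ consists of $0,\pm1,\pm2$ and all $\pm c$ with $c$ the constant of $s_1-s_2$ for such a subformula; $\textsc{Mod}(\varphi)$ consists of $1$ and all $k$ such that an atomic subformula $s_1\equiv_k s_2$ or a quantifier $\exists^{(t,k)}$ occurs in $\varphi$. The quantifier depth $\mathrm{qd}$ is $0$ for atomic formulas, unchanged by $\neg$, the maximum for binary connectives, increased by $1$ by $\exists y$, and increased by $\ell$ by each quantifier $\exists^{(t,p)}(y_1,\dots,y_\ell)$, $\exists^{\ge c}(y_1,\dots,y_\ell)$, $\exists^{=c}(y_1,\dots,y_\ell)$. *)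

theory Defs
  imports "HOL-Number_Theory.Cong" "HOL-Computational_Algebra.Polynomial"
begin

section \<open>Terms\<close>

text \<open>The variable with index \<open>i\<close> is represented by \<open>i :: nat\<close>, assignments are
  functions \<open>nat \<Rightarrow> int\<close>.\<close>

datatype tm = Var nat | Const int | Add tm tm | Mul int tm

primrec tval :: "(nat \<Rightarrow> int) \<Rightarrow> tm \<Rightarrow> int" where
  "tval f (Var x) = f x"
| "tval f (Const c) = c"
| "tval f (Add s t) = tval f s + tval f t"
| "tval f (Mul a t) = a * tval f t"

definition Sub :: "tm \<Rightarrow> tm \<Rightarrow> tm" where
  "Sub s t = Add s (Mul (- 1) t)"

primrec tcoeff :: "tm \<Rightarrow> nat \<Rightarrow> int" where
  "tcoeff (Var x) y = (if x = y then 1 else 0)"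
| "tcoeff (Const c) y = 0"
| "tcoeff (Add s t) y = tcoeff s y + tcoeff t y"
| "tcoeff (Mul a t) y = a * tcoeff t y"

primrec tconst :: "tm \<Rightarrow> int" where
  "tconst (Var x) = 0"
| "tconst (Const c) = c"
| "tconst (Add s t) = tconst s + tconst t"
| "tconst (Mul a t) = a * tconst t"

text \<open>The normal form of \<open>t\<close> is the sum of all \<open>tcoeff t x * x\<close> with \<open>tcoeff t x \<noteq> 0\<close>, plus
  \<open>tconst t\<close>; the next two lemmas state that it is equivalent to \<open>t\<close> and unique.\<close>

definition coeffs_nf :: "tm \<Rightarrow> int set" where
  "coeffs_nf t = {tcoeff t x | x. tcoeff t x \<noteq> 0}"

lemma finite_tcoeff: "finite {x. tcoeff t x \<noteq> 0}"
proof (induction t)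
  case (Add s t)
  have "{x. tcoeff (Add s t) x \<noteq> 0} \<subseteq> {x. tcoeff s x \<noteq> 0} \<union> {x. tcoeff t x \<noteq> 0}" by auto
  then show ?case using Add finite_subset by blast
next
  case (Mul a t)
  have "{x. tcoeff (Mul a t) x \<noteq> 0} \<subseteq> {x. tcoeff t x \<noteq> 0}" by auto
  then show ?case using Mul finite_subset by blast
qed simp_all

lemma tval_nf: "tval f t = (\<Sum>x | tcoeff t x \<noteq> 0. tcoeff t x * f x) + tconst t"
proof -
  have "\<And>A. finite A \<Longrightarrow> {x. tcoeff t x \<noteq> 0} \<subseteq> A \<Longrightarrow>
      tval f t = (\<Sum>x\<in>A. tcoeff t x * f x) + tconst t"
  proof (induction t)
    case (Var x)
    then have "x \<in> A" by auto
    then show ?case using Var(1)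
      by (simp add: if_distrib[of "\<lambda>z. z * _"] sum.delta cong: if_cong)
  next
    case (Add s t)
    let ?B = "A \<union> {x. tcoeff s x \<noteq> 0} \<union> {x. tcoeff t x \<noteq> 0}"
    have fin: "finite ?B" using Add.prems finite_tcoeff by auto
    have 1: "tval f s = (\<Sum>x\<in>?B. tcoeff s x * f x) + tconst s" by (rule Add.IH(1)[OF fin]) auto
    have 2: "tval f t = (\<Sum>x\<in>?B. tcoeff t x * f x) + tconst t" by (rule Add.IH(2)[OF fin]) auto
    have "(\<Sum>x\<in>A. tcoeff (Add s t) x * f x) = (\<Sum>x\<in>?B. tcoeff (Add s t) x * f x)"
      by (rule sum.mono_neutral_left[OF fin]) (use Add.prems in auto)
    also have "\<dots> = (\<Sum>x\<in>?B. tcoeff s x * f x) + (\<Sum>x\<in>?B. tcoeff t x * f x)"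
      by (simp add: distrib_right sum.distrib)
    finally show ?case using 1 2 by simp
  next
    case (Mul a t)
    show ?case
    proof (cases "a = 0")
      case False
      then have "{x. tcoeff t x \<noteq> 0} \<subseteq> A" using Mul.prems by auto
      then have "tval f t = (\<Sum>x\<in>A. tcoeff t x * f x) + tconst t" using Mul by blast
      then show ?thesis by (simp add: distrib_left sum_distrib_left mult.assoc)
    qed simp
  qed simp
  then show ?thesis using finite_tcoeff by blast
qed

lemma nf_unique:
  assumes "finite A" "\<And>x. x \<in> A \<Longrightarrow> a x \<noteq> 0"
    and eq: "\<And>f. tval f t = (\<Sum>x\<in>A. a x * f x) + c"
  shows "c = tconst t" "A = {x. tcoeff t x \<noteq> 0}" "\<And>x. x \<in> A \<Longrightarrow> a x = tcoeff t x"
proof -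
  show c: "c = tconst t"
    using eq[of "\<lambda>_. 0"] tval_nf[of "\<lambda>_. 0" t] by simp
  have *: "(if y \<in> A then a y else 0) = tcoeff t y" for y
  proof -
    let ?f = "\<lambda>x. if x = y then 1 else 0 :: int"
    have "(\<Sum>x\<in>A. a x * ?f x) = (if y \<in> A then a y else 0)"
      using assms(1) by (simp add: if_distrib[of "\<lambda>z. _ * z"] sum.delta cong: if_cong)
    moreover have "(\<Sum>x | tcoeff t x \<noteq> 0. tcoeff t x * ?f x) = tcoeff t y"
      using finite_tcoeff[of t]
      by (simp add: if_distrib[of "\<lambda>z. _ * z"] sum.delta cong: if_cong)
    ultimately show ?thesis using eq[of ?f] tval_nf[of ?f t] c by linarith
  qed
  show "A = {x. tcoeff t x \<noteq> 0}"
  proof (rule set_eqI)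
    fix y show "(y \<in> A) = (y \<in> {x. tcoeff t x \<noteq> 0})"
      using *[of y] assms(2)[of y] by (cases "y \<in> A") auto
  qed
  show "a x = tcoeff t x" if "x \<in> A" for x using *[of x] that by simp
qed

section \<open>Formulas\<close>

text \<open>\<open>CongAt k s t\<close> is the atomic formula saying that \<open>k\<close> divides \<open>s - t\<close>. \<open>ExMod t p ys \<phi>\<close>,
  \<open>ExGe c ys \<phi>\<close>, \<open>ExEq c ys \<phi>\<close> are the modulo-counting quantifier with residue \<open>t\<close> and modulus
  \<open>p\<close>, the threshold-counting quantifier and the exact-counting quantifier over the tuple \<open>ys\<close>.\<close>

datatype fm =
    Less tm tm
  | CongAt nat tm tm
  | Neg fm
  | Conj fm fm
  | Disj fm fm
  | Impl fm fm
  | Equiv fm fm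
  | Ex nat fm
  | ExMod tm nat "nat list" fm
  | ExGe nat "nat list" fm
  | ExEq nat "nat list" fm

definition tuple_ok :: "nat list \<Rightarrow> bool" where
  "tuple_ok ys \<longleftrightarrow> 1 \<le> length ys \<and> distinct ys"

text \<open>The side conditions of the syntax: the formulas of the logic with all counting quantifiers
  are the \<open>\<phi>\<close> with \<open>wf_fm \<phi>\<close>.\<close>

primrec wf_fm :: "fm \<Rightarrow> bool" where
  "wf_fm (Less s t) \<longleftrightarrow> True"
| "wf_fm (CongAt k s t) \<longleftrightarrow> 1 \<le> k"
| "wf_fm (Neg \<phi>) \<longleftrightarrow> wf_fm \<phi>"
| "wf_fm (Conj \<phi> \<psi>) \<longleftrightarrow> wf_fm \<phi> \<and> wf_fm \<psi>"
| "wf_fm (Disj \<phi> \<psi>) \<longleftrightarrow> wf_fm \<phi> \<and> wf_fm \<psi>"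
| "wf_fm (Impl \<phi> \<psi>) \<longleftrightarrow> wf_fm \<phi> \<and> wf_fm \<psi>"
| "wf_fm (Equiv \<phi> \<psi>) \<longleftrightarrow> wf_fm \<phi> \<and> wf_fm \<psi>"
| "wf_fm (Ex y \<phi>) \<longleftrightarrow> wf_fm \<phi>"
| "wf_fm (ExMod t p ys \<phi>) \<longleftrightarrow> 2 \<le> p \<and> tuple_ok ys \<and> wf_fm \<phi>"
| "wf_fm (ExGe c ys \<phi>) \<longleftrightarrow> 1 \<le> c \<and> tuple_ok ys \<and> wf_fm \<phi>"
| "wf_fm (ExEq c ys \<phi>) \<longleftrightarrow> 1 \<le> c \<and> tuple_ok ys \<and> wf_fm \<phi>"

text \<open>The fragment whose only counting quantifiers are modulo-counting quantifiers over a single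
  variable with a natural number as residue.\<close>

primrec unary_mod_shape :: "fm \<Rightarrow> bool" where
  "unary_mod_shape (Less s t) \<longleftrightarrow> True"
| "unary_mod_shape (CongAt k s t) \<longleftrightarrow> True"
| "unary_mod_shape (Neg \<phi>) \<longleftrightarrow> unary_mod_shape \<phi>"
| "unary_mod_shape (Conj \<phi> \<psi>) \<longleftrightarrow> unary_mod_shape \<phi> \<and> unary_mod_shape \<psi>"
| "unary_mod_shape (Disj \<phi> \<psi>) \<longleftrightarrow> unary_mod_shape \<phi> \<and> unary_mod_shape \<psi>"
| "unary_mod_shape (Impl \<phi> \<psi>) \<longleftrightarrow> unary_mod_shape \<phi> \<and> unary_mod_shape \<psi>"
| "unary_mod_shape (Equiv \<phi> \<psi>) \<longleftrightarrow> unary_mod_shape \<phi> \<and> unary_mod_shape \<psi>"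
| "unary_mod_shape (Ex y \<phi>) \<longleftrightarrow> unary_mod_shape \<phi>"
| "unary_mod_shape (ExMod t p ys \<phi>) \<longleftrightarrow>
     (\<exists>q :: nat. t = Const (int q)) \<and> (\<exists>y. ys = [y]) \<and> unary_mod_shape \<phi>"
| "unary_mod_shape (ExGe c ys \<phi>) \<longleftrightarrow> False"
| "unary_mod_shape (ExEq c ys \<phi>) \<longleftrightarrow> False"

definition FO_counting :: "fm set" where
  "FO_counting = {\<phi>. wf_fm \<phi>}"

definition FO_unary_mod :: "fm set" where
  "FO_unary_mod = {\<phi>. wf_fm \<phi> \<and> unary_mod_shape \<phi>}"

definition upd :: "(nat \<Rightarrow> int) \<Rightarrow> nat list \<Rightarrow> int list \<Rightarrow> nat \<Rightarrow> int" where
  "upd f ys as = fold (\<lambda>(y, a) g. g(y := a)) (zip ys as) f"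

primrec sat :: "(nat \<Rightarrow> int) \<Rightarrow> fm \<Rightarrow> bool" where
  "sat f (Less s t) \<longleftrightarrow> tval f s < tval f t"
| "sat f (CongAt k s t) \<longleftrightarrow> [tval f s = tval f t] (mod int k)"
| "sat f (Neg \<phi>) \<longleftrightarrow> \<not> sat f \<phi>"
| "sat f (Conj \<phi> \<psi>) \<longleftrightarrow> sat f \<phi> \<and> sat f \<psi>"
| "sat f (Disj \<phi> \<psi>) \<longleftrightarrow> sat f \<phi> \<or> sat f \<psi>"
| "sat f (Impl \<phi> \<psi>) \<longleftrightarrow> (sat f \<phi> \<longrightarrow> sat f \<psi>)"
| "sat f (Equiv \<phi> \<psi>) \<longleftrightarrow> (sat f \<phi> \<longleftrightarrow> sat f \<psi>)"
| "sat f (Ex y \<phi>) \<longleftrightarrow> (\<exists>a. sat (f(y := a)) \<phi>)"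
| "sat f (ExMod t p ys \<phi>) \<longleftrightarrow>
     (let W = {as. length as = length ys \<and> sat (upd f ys as) \<phi>}
      in finite W \<and> [int (card W) = tval f t] (mod int p))"
| "sat f (ExGe c ys \<phi>) \<longleftrightarrow>
     (let W = {as. length as = length ys \<and> sat (upd f ys as) \<phi>}
      in infinite W \<or> c \<le> card W)"
| "sat f (ExEq c ys \<phi>) \<longleftrightarrow>
     (let W = {as. length as = length ys \<and> sat (upd f ys as) \<phi>}
      in finite W \<and> card W = c)"

definition equivalent :: "fm \<Rightarrow> fm \<Rightarrow> bool" where
  "equivalent \<phi> \<psi> \<longleftrightarrow> (\<forall>f. sat f \<phi> \<longleftrightarrow> sat f \<psi>)"

section \<open>Parameters of formulas\<close>

primrec less_atoms :: "fm \<Rightarrow> (tm \<times> tm) set" where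
  "less_atoms (Less s t) = {(s, t)}"
| "less_atoms (CongAt k s t) = {}"
| "less_atoms (Neg \<phi>) = less_atoms \<phi>"
| "less_atoms (Conj \<phi> \<psi>) = less_atoms \<phi> \<union> less_atoms \<psi>"
| "less_atoms (Disj \<phi> \<psi>) = less_atoms \<phi> \<union> less_atoms \<psi>"
| "less_atoms (Impl \<phi> \<psi>) = less_atoms \<phi> \<union> less_atoms \<psi>"
| "less_atoms (Equiv \<phi> \<psi>) = less_atoms \<phi> \<union> less_atoms \<psi>"
| "less_atoms (Ex y \<phi>) = less_atoms \<phi>"
| "less_atoms (ExMod t p ys \<phi>) = less_atoms \<phi>"
| "less_atoms (ExGe c ys \<phi>) = less_atoms \<phi>"
| "less_atoms (ExEq c ys \<phi>) = less_atoms \<phi>"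

primrec moduli :: "fm \<Rightarrow> nat set" where
  "moduli (Less s t) = {}"
| "moduli (CongAt k s t) = {k}"
| "moduli (Neg \<phi>) = moduli \<phi>"
| "moduli (Conj \<phi> \<psi>) = moduli \<phi> \<union> moduli \<psi>"
| "moduli (Disj \<phi> \<psi>) = moduli \<phi> \<union> moduli \<psi>"
| "moduli (Impl \<phi> \<psi>) = moduli \<phi> \<union> moduli \<psi>"
| "moduli (Equiv \<phi> \<psi>) = moduli \<phi> \<union> moduli \<psi>"
| "moduli (Ex y \<phi>) = moduli \<phi>"
| "moduli (ExMod t p ys \<phi>) = insert p (moduli \<phi>)"
| "moduli (ExGe c ys \<phi>) = moduli \<phi>"
| "moduli (ExEq c ys \<phi>) = moduli \<phi>"

definition Coeff :: "fm \<Rightarrow> int set" where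
  "Coeff \<phi> = {0, 1, - 1, 2, - 2} \<union>
     (\<Union>(s, t) \<in> less_atoms \<phi>. \<Union>a \<in> coeffs_nf (Sub s t). {a, - a})"

definition Constants :: "fm \<Rightarrow> int set" where
  "Constants \<phi> = {0, 1, - 1, 2, - 2} \<union>
     (\<Union>(s, t) \<in> less_atoms \<phi>. {tconst (Sub s t), - tconst (Sub s t)})"

definition Mod :: "fm \<Rightarrow> nat set" where
  "Mod \<phi> = insert 1 (moduli \<phi>)"

primrec qd :: "fm \<Rightarrow> nat" where
  "qd (Less s t) = 0"
| "qd (CongAt k s t) = 0"
| "qd (Neg \<phi>) = qd \<phi>"
| "qd (Conj \<phi> \<psi>) = max (qd \<phi>) (qd \<psi>)"
| "qd (Disj \<phi> \<psi>) = max (qd \<phi>) (qd \<psi>)"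
| "qd (Impl \<phi> \<psi>) = max (qd \<phi>) (qd \<psi>)"
| "qd (Equiv \<phi> \<psi>) = max (qd \<phi>) (qd \<psi>)"
| "qd (Ex y \<phi>) = qd \<phi> + 1"
| "qd (ExMod t p ys \<phi>) = qd \<phi> + length ys"
| "qd (ExGe c ys \<phi>) = qd \<phi> + length ys"
| "qd (ExEq c ys \<phi>) = qd \<phi> + length ys"

text \<open>Binary notation, least significant bit first, without leading zeros; 0 is the empty word.\<close>

fun bits :: "nat \<Rightarrow> bool list" where
  "bits n = (if n = 0 then [] else odd n # bits (n div 2))"

declare bits.simps [simp del]

text \<open>In the size of a formula every symbol counts 1, and every number (including the index of a
  variable) additionally contributes its number of binary digits.\<close>

definition nat_size :: "nat \<Rightarrow> nat" where
  "nat_size n = 1 + length (bits n)"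

definition int_size :: "int \<Rightarrow> nat" where
  "int_size z = 1 + length (bits (nat \<bar>z\<bar>))"

primrec tm_size :: "tm \<Rightarrow> nat" where
  "tm_size (Var x) = nat_size x"
| "tm_size (Const c) = int_size c"
| "tm_size (Add s t) = 1 + tm_size s + tm_size t"
| "tm_size (Mul a t) = 1 + int_size a + tm_size t"

primrec fm_size :: "fm \<Rightarrow> nat" where
  "fm_size (Less s t) = 1 + tm_size s + tm_size t"
| "fm_size (CongAt k s t) = 1 + nat_size k + tm_size s + tm_size t"
| "fm_size (Neg \<phi>) = 1 + fm_size \<phi>"
| "fm_size (Conj \<phi> \<psi>) = 1 + fm_size \<phi> + fm_size \<psi>"
| "fm_size (Disj \<phi> \<psi>) = 1 + fm_size \<phi> + fm_size \<psi>"
| "fm_size (Impl \<phi> \<psi>) = 1 + fm_size \<phi> + fm_size \<psi>"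
| "fm_size (Equiv \<phi> \<psi>) = 1 + fm_size \<phi> + fm_size \<psi>"
| "fm_size (Ex y \<phi>) = 1 + nat_size y + fm_size \<phi>"
| "fm_size (ExMod t p ys \<phi>) =
     1 + tm_size t + nat_size p + sum_list (map nat_size ys) + fm_size \<phi>"
| "fm_size (ExGe c ys \<phi>) = 1 + nat_size c + sum_list (map nat_size ys) + fm_size \<phi>"
| "fm_size (ExEq c ys \<phi>) = 1 + nat_size c + sum_list (map nat_size ys) + fm_size \<phi>"

section \<open>Computations and their running time\<close>

text \<open>Algorithms are programs of a first-order functional language over binary trees with a single
  atom, in the style of Jones' language F (Computability and Complexity from a Programming
  Perspective). A program is a finite list of function bodies; function \<open>i\<close> is called by
  \<open>Call i\<close>, and \<open>Arg i\<close> refers to position \<open>i\<close> of the current environment, which holds the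
  locally bound values followed by the arguments of the current call. The only operations on data
  are building and decomposing pairs and testing for the atom.\<close>

datatype tree = Leaf | Pair tree tree

datatype expr =
    Arg nat
  | LeafE
  | PairE expr expr
  | Fst expr
  | Snd expr
  | IfPair expr expr expr
  | LetE expr expr
  | Call nat "expr list"

type_synonym program = "expr list"

primrec tree_size :: "tree \<Rightarrow> nat" where
  "tree_size Leaf = 1"
| "tree_size (Pair a b) = 1 + tree_size a + tree_size b"

primrec tfst :: "tree \<Rightarrow> tree" where
  "tfst Leaf = Leaf"
| "tfst (Pair a b) = a"

primrec tsnd :: "tree \<Rightarrow> tree" where
  "tsnd Leaf = Leaf"
| "tsnd (Pair a b) = b"

text \<open>\<open>eval P env e v n\<close>: in program \<open>P\<close> and environment \<open>env\<close>, the expression \<open>e\<close> evaluates to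
  \<open>v\<close> in time \<open>n\<close>. Every evaluation step is charged the full number of nodes of the value it
  produces, i.e. values are copied and never shared. Hence an evaluation in time \<open>n\<close> can be
  carried out by a Turing machine in time polynomial in \<open>n\<close> and the size of the input, and in
  particular \<open>n\<close> bounds the size of the result written down without sharing
  (\<open>eval_time_ge\<close> below).\<close>

inductive eval :: "program \<Rightarrow> tree list \<Rightarrow> expr \<Rightarrow> tree \<Rightarrow> nat \<Rightarrow> bool"
  and evals :: "program \<Rightarrow> tree list \<Rightarrow> expr list \<Rightarrow> tree list \<Rightarrow> nat \<Rightarrow> bool"
  for P :: program
where
  eval_Arg: "i < length env \<Longrightarrow> eval P env (Arg i) (env ! i) (tree_size (env ! i))"
| eval_Leaf: "eval P env LeafE Leaf (tree_size Leaf)"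
| eval_Pair: "eval P env e1 v1 n1 \<Longrightarrow> eval P env e2 v2 n2 \<Longrightarrow>
    eval P env (PairE e1 e2) (Pair v1 v2) (n1 + n2 + tree_size (Pair v1 v2))"
| eval_Fst: "eval P env e v n \<Longrightarrow> eval P env (Fst e) (tfst v) (n + tree_size (tfst v))"
| eval_Snd: "eval P env e v n \<Longrightarrow> eval P env (Snd e) (tsnd v) (n + tree_size (tsnd v))"
| eval_If_Pair: "eval P env e (Pair a b) n \<Longrightarrow> eval P env e1 v n1 \<Longrightarrow>
    eval P env (IfPair e e1 e2) v (n + n1 + tree_size v)"
| eval_If_Leaf: "eval P env e Leaf n \<Longrightarrow> eval P env e2 v n2 \<Longrightarrow>
    eval P env (IfPair e e1 e2) v (n + n2 + tree_size v)"
| eval_Let: "eval P env e1 v1 n1 \<Longrightarrow> eval P (v1 # env) e2 v n2 \<Longrightarrow>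
    eval P env (LetE e1 e2) v (n1 + n2 + tree_size v)"
| eval_Call: "evals P env es vs n1 \<Longrightarrow> i < length P \<Longrightarrow> eval P vs (P ! i) v n2 \<Longrightarrow>
    eval P env (Call i es) v (n1 + n2 + tree_size v)"
| evals_Nil: "evals P env [] [] 0"
| evals_Cons: "eval P env e v n1 \<Longrightarrow> evals P env es vs n2 \<Longrightarrow>
    evals P env (e # es) (v # vs) (n1 + n2)"

lemma eval_time_ge: "eval P env e v n \<Longrightarrow> tree_size v \<le> n"
  by (induction rule: eval_evals.inducts(1)[where ?P2.0 = "\<lambda>_ _ _ _. True"]) auto

lemma eval_deterministic:
  "eval P env e v n \<Longrightarrow> eval P env e v' n' \<Longrightarrow> v' = v \<and> n' = n"
  "evals P env es vs n \<Longrightarrow> evals P env es vs' n' \<Longrightarrow> vs' = vs \<and> n' = n"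
proof (induction arbitrary: v' n' and vs' n' rule: eval_evals.inducts)
  case (eval_Arg i env) from eval_Arg.prems show ?case by cases auto
next
  case (eval_Leaf env) from eval_Leaf.prems show ?case by cases auto
next
  case (eval_Pair env e1 v1 n1 e2 v2 n2)
  from eval_Pair.prems show ?case by cases (use eval_Pair.IH in blast)
next
  case (eval_Fst env e v n) from eval_Fst.prems show ?case by cases (use eval_Fst.IH in blast)
next
  case (eval_Snd env e v n) from eval_Snd.prems show ?case by cases (use eval_Snd.IH in blast)
next
  case (eval_If_Pair env e a b n e1 v n1 e2)
  from eval_If_Pair.prems show ?case by cases (use eval_If_Pair.IH in blast)+
next
  case (eval_If_Leaf env e n e2 v n2 e1)
  from eval_If_Leaf.prems show ?case by cases (use eval_If_Leaf.IH in blast)+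
next
  case (eval_Let env e1 v1 n1 e2 v n2)
  from eval_Let.prems show ?case by cases (use eval_Let.IH in blast)
next
  case (eval_Call env es vs n1 i v n2)
  from eval_Call.prems show ?case by cases (use eval_Call.IH in blast)
next
  case (evals_Nil env) from evals_Nil.prems show ?case by cases auto
next
  case (evals_Cons env e v n1 es vs n2)
  from evals_Cons.prems show ?case by cases (use evals_Cons.IH in blast)
qed

text \<open>Function 0 is the main function.\<close>

definition computes :: "program \<Rightarrow> tree \<Rightarrow> tree \<Rightarrow> nat \<Rightarrow> bool" where
  "computes P inp outp n \<longleftrightarrow> P \<noteq> [] \<and> eval P [inp] (P ! 0) outp n"

subsection \<open>Formulas as trees\<close>

primrec enc_list :: "tree list \<Rightarrow> tree" where
  "enc_list [] = Leaf"
| "enc_list (t # ts) = Pair t (enc_list ts)"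

definition enc_bool :: "bool \<Rightarrow> tree" where
  "enc_bool b = (if b then Pair Leaf Leaf else Leaf)"

definition enc_nat :: "nat \<Rightarrow> tree" where
  "enc_nat n = enc_list (map enc_bool (bits n))"

definition enc_int :: "int \<Rightarrow> tree" where
  "enc_int z = Pair (enc_bool (z < 0)) (enc_nat (nat \<bar>z\<bar>))"

text \<open>The first component of a node is a tag for the constructor.\<close>

definition node :: "nat \<Rightarrow> tree list \<Rightarrow> tree" where
  "node k ts = Pair (enc_nat k) (enc_list ts)"

primrec enc_tm :: "tm \<Rightarrow> tree" where
  "enc_tm (Var x) = node 0 [enc_nat x]"
| "enc_tm (Const c) = node 1 [enc_int c]"
| "enc_tm (Add s t) = node 2 [enc_tm s, enc_tm t]"
| "enc_tm (Mul a t) = node 3 [enc_int a, enc_tm t]"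

primrec enc_fm :: "fm \<Rightarrow> tree" where
  "enc_fm (Less s t) = node 0 [enc_tm s, enc_tm t]"
| "enc_fm (CongAt k s t) = node 1 [enc_nat k, enc_tm s, enc_tm t]"
| "enc_fm (Neg \<phi>) = node 2 [enc_fm \<phi>]"
| "enc_fm (Conj \<phi> \<psi>) = node 3 [enc_fm \<phi>, enc_fm \<psi>]"
| "enc_fm (Disj \<phi> \<psi>) = node 4 [enc_fm \<phi>, enc_fm \<psi>]"
| "enc_fm (Impl \<phi> \<psi>) = node 5 [enc_fm \<phi>, enc_fm \<psi>]"
| "enc_fm (Equiv \<phi> \<psi>) = node 6 [enc_fm \<phi>, enc_fm \<psi>]"
| "enc_fm (Ex y \<phi>) = node 7 [enc_nat y, enc_fm \<phi>]"
| "enc_fm (ExMod t p ys \<phi>) =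
     node 8 [enc_tm t, enc_nat p, enc_list (map enc_nat ys), enc_fm \<phi>]"
| "enc_fm (ExGe c ys \<phi>) = node 9 [enc_nat c, enc_list (map enc_nat ys), enc_fm \<phi>]"
| "enc_fm (ExEq c ys \<phi>) = node 10 [enc_nat c, enc_list (map enc_nat ys), enc_fm \<phi>]"

lemma enc_list_inj: "enc_list xs = enc_list ys \<longleftrightarrow> xs = ys"
proof (induction xs arbitrary: ys)
  case Nil then show ?case by (cases ys) auto
next
  case (Cons x xs) then show ?case by (cases ys) auto
qed

lemma bits_inj: "bits m = bits n \<longleftrightarrow> m = n"
proof (induction m arbitrary: n rule: less_induct)
  case (less m)
  show ?case
  proof (cases "m = 0 \<or> n = 0")
    case True
    then show ?thesis by (auto simp: bits.simps[of m] bits.simps[of n])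
  next
    case False
    then have "bits m = bits n \<longleftrightarrow> odd m = odd n \<and> m div 2 = n div 2"
      using less.IH[of "m div 2" "n div 2"]
      by (subst bits.simps[of m], subst bits.simps[of n]) auto
    also have "\<dots> \<longleftrightarrow> m = n"
      by (metis odd_two_times_div_two_succ even_two_times_div_two)
    finally show ?thesis .
  qed
qed

lemma enc_nat_inj: "enc_nat m = enc_nat n \<longleftrightarrow> m = n"
proof -
  have "inj enc_bool" by (rule injI) (auto simp: enc_bool_def split: if_splits)
  then show ?thesis by (simp add: enc_nat_def enc_list_inj bits_inj inj_map_eq_map)
qed

lemma enc_int_inj: "enc_int a = enc_int b \<longleftrightarrow> a = b"
  by (auto simp: enc_int_def enc_bool_def enc_nat_inj split: if_splits)

lemma node_inj: "node k ts = node l us \<longleftrightarrow> k = l \<and> ts = us"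
  by (simp add: node_def enc_nat_inj enc_list_inj)

lemma enc_tm_inj: "enc_tm s = enc_tm t \<longleftrightarrow> s = t"
proof (induction s arbitrary: t)
  case (Var x) show ?case by (cases t) (auto simp: node_inj enc_nat_inj)
next
  case (Const x) show ?case by (cases t) (auto simp: node_inj enc_int_inj)
next
  case (Add s1 s2) then show ?case by (cases t) (auto simp: node_inj)
next
  case (Mul x s) then show ?case by (cases t) (auto simp: node_inj enc_int_inj)
qed

lemma enc_fm_inj: "enc_fm \<phi> = enc_fm \<psi> \<longleftrightarrow> \<phi> = \<psi>"
proof -
  have [simp]: "map enc_nat xs = map enc_nat ys \<longleftrightarrow> xs = ys" for xs ys
    by (rule inj_map_eq_map) (simp add: inj_def enc_nat_inj)
  show ?thesis
  proof (induction \<phi> arbitrary: \<psi>)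
    case (Less s t) show ?case by (cases \<psi>) (auto simp: node_inj enc_tm_inj)
  next
    case (CongAt k s t) show ?case
      by (cases \<psi>) (auto simp: node_inj enc_tm_inj enc_nat_inj)
  next
    case (Neg \<phi>) then show ?case by (cases \<psi>) (auto simp: node_inj)
  next
    case (Conj \<phi>1 \<phi>2) then show ?case by (cases \<psi>) (auto simp: node_inj)
  next
    case (Disj \<phi>1 \<phi>2) then show ?case by (cases \<psi>) (auto simp: node_inj)
  next
    case (Impl \<phi>1 \<phi>2) then show ?case by (cases \<psi>) (auto simp: node_inj)
  next
    case (Equiv \<phi>1 \<phi>2) then show ?case by (cases \<psi>) (auto simp: node_inj)
  next
    case (Ex y \<phi>) then show ?case by (cases \<psi>) (auto simp: node_inj enc_nat_inj)
  next
    case (ExMod t p ys \<phi>) then show ?case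
      by (cases \<psi>) (auto simp: node_inj enc_nat_inj enc_tm_inj enc_list_inj)
  next
    case (ExGe c ys \<phi>) then show ?case
      by (cases \<psi>) (auto simp: node_inj enc_nat_inj enc_list_inj)
  next
    case (ExEq c ys \<phi>) then show ?case
      by (cases \<psi>) (auto simp: node_inj enc_nat_inj enc_list_inj)
  qed
qed

text \<open>The size of a formula and the size of its tree agree up to a constant factor.\<close>

lemma tree_size_enc_nat: "nat_size n \<le> tree_size (enc_nat n)" "tree_size (enc_nat n) \<le> 4 * nat_size n"
proof -
  have "length bs + 1 \<le> tree_size (enc_list (map enc_bool bs)) \<and>
      tree_size (enc_list (map enc_bool bs)) \<le> 4 * length bs + 1" for bs
    by (induction bs) (auto simp: enc_bool_def)
  from this[of "bits n"]
  show "nat_size n \<le> tree_size (enc_nat n)" "tree_size (enc_nat n) \<le> 4 * nat_size n"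
    by (auto simp: enc_nat_def nat_size_def)
qed

lemma tree_size_enc_int: "int_size z \<le> tree_size (enc_int z)" "tree_size (enc_int z) \<le> 8 * int_size z"
  using tree_size_enc_nat[of "nat \<bar>z\<bar>"]
  by (auto simp: enc_int_def enc_bool_def int_size_def nat_size_def)

lemma tree_size_enc_nats:
  "sum_list (map nat_size ys) \<le> tree_size (enc_list (map enc_nat ys))"
  "tree_size (enc_list (map enc_nat ys)) \<le> 5 * sum_list (map nat_size ys) + 1"
proof (induction ys)
  case (Cons y ys)
  have "1 \<le> nat_size y" by (simp add: nat_size_def)
  then show "sum_list (map nat_size (y # ys)) \<le> tree_size (enc_list (map enc_nat (y # ys)))"
    "tree_size (enc_list (map enc_nat (y # ys))) \<le> 5 * sum_list (map nat_size (y # ys)) + 1"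
    using Cons tree_size_enc_nat[of y] by simp_all
qed simp_all

lemma tree_size_node:
  assumes "k \<le> 10"
  shows "tree_size (node k ts) \<le> 22 + sum_list (map tree_size ts) + length ts"
    and "1 + sum_list (map tree_size ts) \<le> tree_size (node k ts)"
proof -
  have 1: "tree_size (enc_list ts) = 1 + sum_list (map tree_size ts) + length ts"
    by (induction ts) auto
  have "n < 2 ^ m \<Longrightarrow> length (bits n) \<le> m" for m n
  proof (induction m arbitrary: n)
    case 0
    then show ?case by (simp add: bits.simps)
  next
    case (Suc m)
    then have "length (bits (n div 2)) \<le> m" by auto
    then show ?case by (simp add: bits.simps[of n])
  qed
  from this[of k 4] have "nat_size k \<le> 5" using assms by (simp add: nat_size_def)
  then have "tree_size (enc_nat k) \<le> 20" using tree_size_enc_nat(2)[of k] by linarith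
  with 1 show "tree_size (node k ts) \<le> 22 + sum_list (map tree_size ts) + length ts"
    by (simp add: node_def)
  show "1 + sum_list (map tree_size ts) \<le> tree_size (node k ts)"
    by (simp add: node_def 1)
qed

lemma tree_size_enc_tm: "tm_size t \<le> tree_size (enc_tm t)" "tree_size (enc_tm t) \<le> 40 * tm_size t"
proof (induction t)
  case (Var x)
  have "1 \<le> nat_size x" by (simp add: nat_size_def)
  then show "tm_size (Var x) \<le> tree_size (enc_tm (Var x))"
    "tree_size (enc_tm (Var x)) \<le> 40 * tm_size (Var x)"
    using tree_size_enc_nat[of x] tree_size_node[of 0 "[enc_nat x]"] by simp_all
next
  case (Const c)
  have "1 \<le> int_size c" by (simp add: int_size_def)
  then show "tm_size (Const c) \<le> tree_size (enc_tm (Const c))"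
    "tree_size (enc_tm (Const c)) \<le> 40 * tm_size (Const c)"
    using tree_size_enc_int[of c] tree_size_node[of 1 "[enc_int c]"] by simp_all
next
  case (Add s t)
  then show "tm_size (Add s t) \<le> tree_size (enc_tm (Add s t))"
    "tree_size (enc_tm (Add s t)) \<le> 40 * tm_size (Add s t)"
    using tree_size_node[of 2 "[enc_tm s, enc_tm t]"] by simp_all
next
  case (Mul a t)
  then show "tm_size (Mul a t) \<le> tree_size (enc_tm (Mul a t))"
    "tree_size (enc_tm (Mul a t)) \<le> 40 * tm_size (Mul a t)"
    using tree_size_enc_int[of a] tree_size_node[of 3 "[enc_int a, enc_tm t]"] by simp_all
qed

lemma tree_size_enc_fm:
  "fm_size \<phi> \<le> tree_size (enc_fm \<phi>) \<and> tree_size (enc_fm \<phi>) \<le> 40 * fm_size \<phi>"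
proof (induction \<phi>)
  case (Less s t)
  then show ?case
    using tree_size_enc_tm[of s] tree_size_enc_tm[of t]
      tree_size_node[of 0 "[enc_tm s, enc_tm t]"] by simp
next
  case (CongAt k s t)
  then show ?case
    using tree_size_enc_tm[of s] tree_size_enc_tm[of t] tree_size_enc_nat[of k]
      tree_size_node[of 1 "[enc_nat k, enc_tm s, enc_tm t]"] by simp
next
  case (Neg \<phi>)
  then show ?case using tree_size_node[of 2 "[enc_fm \<phi>]"] by simp
next
  case (Conj \<phi> \<psi>)
  then show ?case using tree_size_node[of 3 "[enc_fm \<phi>, enc_fm \<psi>]"] by simp
next
  case (Disj \<phi> \<psi>)
  then show ?case using tree_size_node[of 4 "[enc_fm \<phi>, enc_fm \<psi>]"] by simp
next
  case (Impl \<phi> \<psi>)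
  then show ?case using tree_size_node[of 5 "[enc_fm \<phi>, enc_fm \<psi>]"] by simp
next
  case (Equiv \<phi> \<psi>)
  then show ?case using tree_size_node[of 6 "[enc_fm \<phi>, enc_fm \<psi>]"] by simp
next
  case (Ex y \<phi>)
  then show ?case
    using tree_size_enc_nat[of y] tree_size_node[of 7 "[enc_nat y, enc_fm \<phi>]"] by simp
next
  case (ExMod t p ys \<phi>)
  then show ?case
    using tree_size_enc_tm[of t] tree_size_enc_nat[of p] tree_size_enc_nats[of ys]
      tree_size_node[of 8 "[enc_tm t, enc_nat p, enc_list (map enc_nat ys), enc_fm \<phi>]"] by simp
next
  case (ExGe c ys \<phi>)
  then show ?case
    using tree_size_enc_nat[of c] tree_size_enc_nats[of ys]
      tree_size_node[of 9 "[enc_nat c, enc_list (map enc_nat ys), enc_fm \<phi>]"] by simp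
next
  case (ExEq c ys \<phi>)
  then show ?case
    using tree_size_enc_nat[of c] tree_size_enc_nats[of ys]
      tree_size_node[of 10 "[enc_nat c, enc_list (map enc_nat ys), enc_fm \<phi>]"] by simp
qed

end

(* Values are copied but never shared, so a body that makes boundedly many calls turns a bound K on
   the growth factor of calls of depth h into a bound polynomial in K for depth h + 1. Hence every
   computation of call depth h takes time at most 5^(D^h) times the size of the input, and it is
   enough to give a program whose call depth, rather than running time, is polynomial. This rules out
   loops up to c or p; all loops run over binary digits.

   Threshold quantifiers are halved: W has at least c > 0 elements iff some x in W has c div 2 elements of
   W lexicographically below it and c div 2 above it (or not below it, if c is even). This needs a
   quantifier depth of only length ys for each binary digit of c.

   For a modulo-counting quantifier over (y, ys), the cardinality of W is modulo p the sum over j < p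
   of j times the number of a whose slice has cardinality congruent to j. The sum is evaluated along a
   binary tree over the residues j, where the split of the total between the two subtrees is guessed
   by an existentially quantified fresh variable. *)

theory Submission
  imports Defs "HOL-Library.List_Lexorder"
begin

section \<open>Call depth bounds running time\<close>

text \<open>The values of \<open>c\<close> and \<open>p\<close> may be exponential in the size of
  the input, whereas the quantifier depth must stay polynomial; so a chain of \<open>p\<close>
  nested guesses for the partial sums is impossible, and only the number of digits may enter the
  depth. Moreover \<open>Coeff\<close>, \<open>Constants\<close> and \<open>Mod\<close> must not
  grow. They restrict only \<open>Less\<close> atoms and moduli, not the terms inside congruences.
  Therefore every new \<open>Less\<close> atom compares two variables, all arithmetic with residues
  sits in congruences modulo the given \<open>p\<close>, and truth is a congruence modulo 1, which
  belongs to every \<open>Mod\<close>. A modulo-counting quantifier also asserts finiteness, so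
  besides the sum of residues one has to express that all slices are finite and that only finitely
  many are nonempty. Subformulas are duplicated freely. The size of the result is never estimated
  separately, because the time bound covers writing it down without sharing.\<close>

fun runE :: "(nat \<Rightarrow> tree list \<Rightarrow> tree option) \<Rightarrow> expr \<Rightarrow> tree list \<Rightarrow> tree option"
  and runEs :: "(nat \<Rightarrow> tree list \<Rightarrow> tree option) \<Rightarrow> expr list \<Rightarrow> tree list \<Rightarrow> tree list option" where
  "runE c (Arg i) env = (if i < length env then Some (env ! i) else None)"
| "runE c LeafE env = Some Leaf"
| "runE c (PairE a b) env =
     Option.bind (runE c a env) (\<lambda>u. Option.bind (runE c b env) (\<lambda>v. Some (Pair u v)))"
| "runE c (Fst e) env = map_option tfst (runE c e env)"
| "runE c (Snd e) env = map_option tsnd (runE c e env)"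
| "runE c (IfPair e a b) env =
     Option.bind (runE c e env) (\<lambda>v. if v = Leaf then runE c b env else runE c a env)"
| "runE c (LetE a b) env = Option.bind (runE c a env) (\<lambda>v. runE c b (v # env))"
| "runE c (Call i es) env = Option.bind (runEs c es env) (c i)"
| "runEs c [] env = Some []"
| "runEs c (e # es) env =
     Option.bind (runE c e env) (\<lambda>v. Option.bind (runEs c es env) (\<lambda>vs. Some (v # vs)))"

text \<open>\<open>h\<close> is fuel for nested calls, and exhausted fuel gives \<open>None\<close>.
  Without a time component the simplifier can run function bodies; time enters only through
  \<open>run_time\<close>.\<close>

primrec call :: "program \<Rightarrow> nat \<Rightarrow> nat \<Rightarrow> tree list \<Rightarrow> tree option" where
  "call P 0 = (\<lambda>i vs. None)"
| "call P (Suc h) = (\<lambda>i vs. if i < length P then runE (call P h) (P ! i) vs else None)"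

text \<open>The exponent in the bound of \<open>run_time\<close>. Every constructor and every entry
  of an argument list contributes one factor of the base, which absorbs its own cost.\<close>

primrec weight :: "expr \<Rightarrow> nat" where
  "weight (Arg i) = 1"
| "weight LeafE = 1"
| "weight (PairE a b) = 1 + weight a + weight b"
| "weight (Fst e) = 1 + weight e"
| "weight (Snd e) = 1 + weight e"
| "weight (IfPair e a b) = 1 + weight e + weight a + weight b"
| "weight (LetE a b) = 1 + weight a + weight b"
| "weight (Call i es) = 1 + sum_list (map (\<lambda>w. 1 + w) (map weight es))"

text \<open>The 1 keeps the size positive for the empty environment, so that additive constants are
  absorbed by multiples of it.\<close>

abbreviation env_size :: "tree list \<Rightarrow> nat" where
  "env_size vs \<equiv> 1 + sum_list (map tree_size vs)"

lemma tree_size_tfst: "tree_size (tfst t) \<le> tree_size t"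
  by (cases t) auto

lemma tree_size_tsnd: "tree_size (tsnd t) \<le> tree_size t"
  by (cases t) auto

lemma add_le_twice_mult: "1 \<le> x \<Longrightarrow> 1 \<le> y \<Longrightarrow> x + y \<le> 2 * (x * y)" for x y :: nat
proof -
  assume "1 \<le> x" "1 \<le> y"
  then show ?thesis using mult_le_mono2[of 1 y x] mult_le_mono1[of 1 x y] by linarith
qed

text \<open>Sums of bounds are replaced by twice their product. In the base, 5 is what a pair or a
  let costs relative to the product of the bounds of its two parts. The summand \<open>4 * K\<close>
  is for calls: the arguments have size at most twice their time bound, and the value of the call is
  charged a second time.\<close>

lemma run_time:
  assumes call: "\<And>i vs v. c i vs = Some v \<Longrightarrow>
      i < length P \<and> (\<exists>n. eval P vs (P ! i) v n \<and> n \<le> K * env_size vs)"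
    and a: "a = 5 + 4 * K"
  shows "runE c e env = Some v \<Longrightarrow>
      \<exists>n. eval P env e v n \<and> n \<le> a ^ weight e * env_size env"
    and "runEs c es env = Some vs \<Longrightarrow>
      \<exists>n. evals P env es vs n \<and> sum_list (map tree_size vs) \<le> n \<and>
        n \<le> a ^ sum_list (map (\<lambda>w. 1 + w) (map weight es)) * env_size env"
proof (induction c\<equiv>c e env and c\<equiv>c es env arbitrary: v and vs rule: runE_runEs.induct)
  case (1 i env)
  then have i: "i < length env" and v: "v = env ! i" by (auto split: if_splits)
  have "tree_size v \<in> set (map tree_size env)" using i v by simp
  then have "tree_size v \<le> sum_list (map tree_size env)" by (rule member_le_sum_list) auto
  moreover have "1 * env_size env \<le> a ^ weight (Arg i) * env_size env"
    by (intro mult_le_mono) (auto simp: a)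
  ultimately show ?case using eval_Arg[OF i, of P] v by (intro exI[of _ "tree_size v"]) auto
next
  case (2 env)
  then show ?case using eval_Leaf[of P env] by (intro exI[of _ 1]) (auto simp: a)
next
  case (3 e1 e2 env)
  then obtain v1 v2 where v: "runE c e1 env = Some v1" "runE c e2 env = Some v2" "v = Pair v1 v2"
    by (auto simp: bind_eq_Some_conv)
  from 3(1)[OF v(1)] obtain n1 where n1: "eval P env e1 v1 n1" "n1 \<le> a ^ weight e1 * env_size env"
    by blast
  from 3(2)[OF v(1) v(2)] obtain n2 where n2: "eval P env e2 v2 n2" "n2 \<le> a ^ weight e2 * env_size env"
    by blast
  let ?m = "env_size env"
  have p: "a ^ weight e1 + a ^ weight e2 \<le> 2 * (a ^ weight e1 * a ^ weight e2)"
    by (rule add_le_twice_mult) (auto simp: a)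
  have "1 \<le> a ^ weight e1 * a ^ weight e2 * ?m" by (simp add: a Suc_le_eq)
  moreover have "n1 + n2 \<le> 2 * (a ^ weight e1 * a ^ weight e2 * ?m)"
    using mult_le_mono1[OF p, of ?m] n1(2) n2(2) by (simp add: algebra_simps)
  moreover have "tree_size v1 \<le> n1" "tree_size v2 \<le> n2" using n1 n2 eval_time_ge by auto
  ultimately have "n1 + n2 + tree_size v \<le> 5 * (a ^ weight e1 * a ^ weight e2 * ?m)"
    using v(3) by simp
  also have "\<dots> \<le> a * (a ^ weight e1 * a ^ weight e2 * ?m)" by (intro mult_le_mono1) (simp add: a)
  also have "\<dots> = a ^ weight (PairE e1 e2) * ?m" by (simp add: power_add algebra_simps)
  finally show ?case using eval_Pair[OF n1(1) n2(1)] v(3) by blast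
next
  case (4 e env)
  then obtain u where v: "runE c e env = Some u" "v = tfst u" by auto
  from 4(1)[OF v(1)] obtain n where n: "eval P env e u n" "n \<le> a ^ weight e * env_size env" by blast
  have "tree_size v \<le> n" using v(2) tree_size_tfst[of u] eval_time_ge[OF n(1)] by simp
  then have "n + tree_size v \<le> 2 * (a ^ weight e * env_size env)" using n(2) by linarith
  also have "\<dots> \<le> a * (a ^ weight e * env_size env)" by (intro mult_le_mono1) (simp add: a)
  finally have "n + tree_size v \<le> a ^ weight (Fst e) * env_size env" by (simp add: algebra_simps)
  then show ?case using eval_Fst[OF n(1)] v(2) by blast
next
  case (5 e env)
  then obtain u where v: "runE c e env = Some u" "v = tsnd u" by auto
  from 5(1)[OF v(1)] obtain n where n: "eval P env e u n" "n \<le> a ^ weight e * env_size env" by blast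
  have "tree_size v \<le> n" using v(2) tree_size_tsnd[of u] eval_time_ge[OF n(1)] by simp
  then have "n + tree_size v \<le> 2 * (a ^ weight e * env_size env)" using n(2) by linarith
  also have "\<dots> \<le> a * (a ^ weight e * env_size env)" by (intro mult_le_mono1) (simp add: a)
  finally have "n + tree_size v \<le> a ^ weight (Snd e) * env_size env" by (simp add: algebra_simps)
  then show ?case using eval_Snd[OF n(1)] v(2) by blast
next
  case (6 e e1 e2 env)
  let ?m = "env_size env"
  from 6(4) obtain u where u: "runE c e env = Some u"
    and r: "(if u = Leaf then runE c e2 env else runE c e1 env) = Some v"
    by (auto simp: bind_eq_Some_conv)
  from 6(1)[OF u] obtain n where n: "eval P env e u n" "n \<le> a ^ weight e * ?m" by blast
  obtain n1 w where n1: "n1 \<le> a ^ w * ?m" "w \<le> weight e1 + weight e2"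
    and ev: "eval P env (IfPair e e1 e2) v (n + n1 + tree_size v)" and sv: "tree_size v \<le> n1"
  proof (cases u)
    case Leaf
    with 6(2)[OF u] r obtain n1 where "eval P env e2 v n1" "n1 \<le> a ^ weight e2 * ?m" by auto
    then show ?thesis using that[of n1 "weight e2"] eval_If_Leaf[of P env e n e2 v n1 e1] n(1) Leaf
        eval_time_ge by auto
  next
    case (Pair x y)
    with 6(3)[OF u] r obtain n1 where "eval P env e1 v n1" "n1 \<le> a ^ weight e1 * ?m" by auto
    then show ?thesis using that[of n1 "weight e1"] eval_If_Pair[of P env e x y n e1 v n1 e2] n(1) Pair
        eval_time_ge by auto
  qed
  have "a ^ weight e + a ^ w \<le> 2 * (a ^ weight e * a ^ w)"
    by (rule add_le_twice_mult) (auto simp: a)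
  from mult_le_mono1[OF this, of ?m]
  have "n + n1 + tree_size v \<le> 4 * (a ^ weight e * a ^ w * ?m)"
    using n(2) n1(1) sv by (simp add: algebra_simps)
  also have "\<dots> \<le> a * (a ^ weight e * a ^ w * ?m)" by (intro mult_le_mono1) (simp add: a)
  also have "\<dots> = a ^ (1 + weight e + w) * ?m" by (simp add: power_add algebra_simps)
  also have "\<dots> \<le> a ^ weight (IfPair e e1 e2) * ?m"
    by (intro mult_le_mono1 power_increasing) (use n1(2) in \<open>auto simp: a\<close>)
  finally show ?case using ev by blast
next
  case (7 e1 e2 env)
  let ?m = "env_size env"
  from 7(3) obtain u where u: "runE c e1 env = Some u" "runE c e2 (u # env) = Some v"
    by (auto simp: bind_eq_Some_conv)
  from 7(1)[OF u(1)] obtain n1 where n1: "eval P env e1 u n1" "n1 \<le> a ^ weight e1 * ?m" by blast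
  from 7(2)[OF u] obtain n2 where n2: "eval P (u # env) e2 v n2"
      "n2 \<le> a ^ weight e2 * env_size (u # env)" by blast
  define x y where "x = a ^ weight e1" and "y = a ^ weight e2"
  have xy: "1 \<le> x" "1 \<le> y" by (auto simp: x_def y_def a)
  \<comment> \<open>The bound value enlarges the environment of the second expression; this is why
    the bounds multiply.\<close>
  have "env_size (u # env) \<le> ?m + x * ?m" using eval_time_ge[OF n1(1)] n1(2) by (simp add: x_def)
  also have "\<dots> \<le> 2 * (x * ?m)"
    unfolding mult_2 using mult_le_mono1[OF xy(1), of ?m] by (intro add_mono) simp_all
  finally have "y * env_size (u # env) \<le> y * (2 * (x * ?m))" by (rule mult_le_mono2)
  then have 1: "n2 \<le> 2 * (x * y * ?m)" using n2(2) by (simp add: y_def algebra_simps)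
  have "x * ?m * 1 \<le> x * ?m * y" using xy(2) by (rule mult_le_mono2)
  then have "n1 \<le> x * y * ?m" using n1(2) by (simp add: x_def algebra_simps)
  with 1 have "n1 + n2 + tree_size v \<le> 5 * (x * y * ?m)" using eval_time_ge[OF n2(1)] by linarith
  also have "\<dots> \<le> a * (x * y * ?m)" by (intro mult_le_mono1) (simp add: a)
  also have "\<dots> = a ^ weight (LetE e1 e2) * ?m" by (simp add: power_add algebra_simps x_def y_def)
  finally show ?case using eval_Let[OF n1(1) n2(1)] by blast
next
  case (8 i es env)
  let ?m = "env_size env" and ?w = "sum_list (map (\<lambda>w. 1 + w) (map weight es))"
  from 8(2) obtain vs where vs: "runEs c es env = Some vs" "c i vs = Some v"
    by (auto simp: bind_eq_Some_conv)
  from 8(1)[OF vs(1)] obtain n1 where n1: "evals P env es vs n1"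
    "sum_list (map tree_size vs) \<le> n1" "n1 \<le> a ^ ?w * ?m" by blast
  from call[OF vs(2)] obtain n2 where i: "i < length P" and n2: "eval P vs (P ! i) v n2"
    "n2 \<le> K * env_size vs" by blast
  have A: "1 \<le> a ^ ?w * ?m" by (simp add: a Suc_le_eq)
  have "env_size vs \<le> 2 * (a ^ ?w * ?m)" using n1(2,3) A by linarith
  then have "K * env_size vs \<le> K * (2 * (a ^ ?w * ?m))" by (rule mult_le_mono2)
  then have "n1 + n2 + tree_size v \<le> a ^ ?w * ?m + 4 * K * (a ^ ?w * ?m)"
    using n1(3) n2(2) eval_time_ge[OF n2(1)] by linarith
  also have "\<dots> \<le> a * (a ^ ?w * ?m)" by (simp add: a add_mult_distrib)
  finally have "n1 + n2 + tree_size v \<le> a ^ weight (Call i es) * ?m" by (simp add: algebra_simps)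
  then show ?case using eval_Call[OF n1(1) i n2(1)] by blast
next
  case (9 env)
  then show ?case using evals_Nil by auto
next
  case (10 e es env)
  let ?m = "env_size env" and ?w = "sum_list (map (\<lambda>w. 1 + w) (map weight es))"
  from 10(3) obtain u us where u: "runE c e env = Some u" "runEs c es env = Some us" "vs = u # us"
    by (auto simp: bind_eq_Some_conv)
  from 10(1)[OF u(1)] obtain n1 where n1: "eval P env e u n1" "n1 \<le> a ^ weight e * ?m" by blast
  from 10(2)[OF u(1,2)] obtain n2 where n2: "evals P env es us n2"
    "sum_list (map tree_size us) \<le> n2" "n2 \<le> a ^ ?w * ?m" by blast
  have "a ^ weight e + a ^ ?w \<le> 2 * (a ^ weight e * a ^ ?w)"
    by (rule add_le_twice_mult) (auto simp: a)
  also have "\<dots> \<le> a * (a ^ weight e * a ^ ?w)" by (intro mult_le_mono1) (simp add: a)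
  finally have "(a ^ weight e + a ^ ?w) * ?m \<le> a * (a ^ weight e * a ^ ?w) * ?m"
    by (rule mult_le_mono1)
  then have "n1 + n2 \<le> a ^ sum_list (map (\<lambda>w. 1 + w) (map weight (e # es))) * ?m"
    using n1(2) n2(3) by (simp add: power_add algebra_simps)
  moreover have "sum_list (map tree_size vs) \<le> n1 + n2"
    using u(3) n2(2) eval_time_ge[OF n1(1)] by simp
  ultimately show ?case using evals_Cons[OF n1(1) n2(1)] u(3) by blast
qed

section \<open>Iterating the bound over the call depth\<close>

primrec growth :: "nat \<Rightarrow> nat \<Rightarrow> nat" where
  "growth C 0 = 0"
| "growth C (Suc h) = (5 + 4 * growth C h) ^ C"

text \<open>If \<open>D\<close> is the exponent at depth \<open>h\<close>, the next level gives at
  most \<open>9 * 5 ^ (D * C)\<close> and hence at most \<open>5 ^ (2 + D * C)\<close>. Since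
  \<open>D\<close> is positive, the 2 is absorbed by using \<open>C + 2\<close> as the base of the
  exponent.\<close>

lemma growth_le: "5 + 4 * growth C h \<le> 5 ^ ((C + 2) ^ h)"
proof (induction h)
  case (Suc h)
  let ?D = "(C + 2) ^ h"
  have "growth C (Suc h) \<le> (5 ^ ?D) ^ C" using power_mono[OF Suc] by simp
  then have "5 + 4 * growth C (Suc h) \<le> 9 * 5 ^ (?D * C)"
    using one_le_power[of "5::nat" "?D * C"] unfolding power_mult[symmetric] by linarith
  also have "\<dots> \<le> 5 ^ 2 * 5 ^ (?D * C)" by (intro mult_le_mono1) simp
  also have "\<dots> = 5 ^ (2 + ?D * C)" by (simp only: power_add)
  also have "\<dots> \<le> 5 ^ ((C + 2) ^ Suc h)"
  proof (intro power_increasing)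
    have "1 \<le> ?D" by simp
    then show "2 + ?D * C \<le> (C + 2) ^ Suc h" unfolding power_Suc2 add_mult_distrib2 by linarith
  qed simp
  finally show ?case .
qed simp

lemma call_time_growth:
  assumes C: "\<And>e. e \<in> set P \<Longrightarrow> weight e \<le> C"
  shows "call P h i vs = Some v \<Longrightarrow>
    i < length P \<and> (\<exists>n. eval P vs (P ! i) v n \<and> n \<le> growth C h * env_size vs)"
proof (induction h arbitrary: i vs v)
  case (Suc h)
  from Suc.prems have i: "i < length P" and r: "runE (call P h) (P ! i) vs = Some v"
    by (auto split: if_splits)
  from run_time(1)[OF Suc.IH refl r] obtain n where n: "eval P vs (P ! i) v n"
    "n \<le> (5 + 4 * growth C h) ^ weight (P ! i) * env_size vs" by blast
  have "(5 + 4 * growth C h) ^ weight (P ! i) * env_size vs \<le> growth C (Suc h) * env_size vs"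
    unfolding growth.simps by (intro mult_le_mono1 power_increasing) (use C i in auto)
  with n i show ?case by (meson order_trans)
qed simp

text \<open>\<open>D\<close> depends on the program alone: it is 2 plus the sum of all weights,
  which bounds each single weight.\<close>

lemma call_time:
  "\<exists>D. \<forall>h i vs v. call P h i vs = Some v \<longrightarrow>
    (\<exists>n. eval P vs (P ! i) v n \<and> n \<le> 5 ^ (D ^ h) * env_size vs)"
proof -
  let ?C = "sum_list (map weight P)"
  have "\<exists>n. eval P vs (P ! i) v n \<and> n \<le> 5 ^ ((?C + 2) ^ h) * env_size vs"
    if "call P h i vs = Some v" for h i vs v
  proof -
  note that
  moreover have "weight e \<le> ?C" if "e \<in> set P" for e
    using that by (intro member_le_sum_list) auto
  ultimately obtain n where n: "eval P vs (P ! i) v n" "n \<le> growth ?C h * env_size vs"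
    using call_time_growth by blast
  have "growth ?C h \<le> 5 ^ ((?C + 2) ^ h)" using growth_le[of ?C h] by linarith
  then show ?thesis
    using n by (meson mult_le_mono1 order_trans)
  qed
  then show ?thesis by blast
qed

section \<open>Assignments and dependence on variables\<close>

definition agree :: "nat \<Rightarrow> (nat \<Rightarrow> int) \<Rightarrow> (nat \<Rightarrow> int) \<Rightarrow> bool" where
  "agree x f g \<longleftrightarrow> (\<forall>v<x. f v = g v)"

definition tdep :: "nat \<Rightarrow> tm \<Rightarrow> bool" where
  "tdep x t \<longleftrightarrow> (\<forall>f g. agree x f g \<longrightarrow> tval f t = tval g t)"

text \<open>Dependence is semantic because a translated formula binds variables from
  \<open>x\<close> on and so violates \<open>fm_below\<close>. Being equivalent to the original, it
  still depends only on the variables below \<open>x\<close>.\<close>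

definition dep :: "nat \<Rightarrow> fm \<Rightarrow> bool" where
  "dep x \<phi> \<longleftrightarrow> (\<forall>f g. agree x f g \<longrightarrow> sat f \<phi> = sat g \<phi>)"

lemma agree_mono: "agree x f g \<Longrightarrow> y \<le> x \<Longrightarrow> agree y f g"
  by (auto simp: agree_def)

lemma agree_fun_upd_fresh: "x \<le> z \<Longrightarrow> agree x (f(z := a)) f"
  by (auto simp: agree_def)

lemma agree_fun_upd: "agree x f g \<Longrightarrow> agree x (f(y := a)) (g(y := a))"
  by (auto simp: agree_def)

lemma tdepD: "tdep x t \<Longrightarrow> agree x f g \<Longrightarrow> tval f t = tval g t"
  by (auto simp: tdep_def)

lemma depD: "dep x \<phi> \<Longrightarrow> agree x f g \<Longrightarrow> sat f \<phi> = sat g \<phi>"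
  by (auto simp: dep_def)

lemma dep_mono: "dep x \<phi> \<Longrightarrow> x \<le> y \<Longrightarrow> dep y \<phi>"
  by (meson agree_mono dep_def)

lemma tdep_mono: "tdep x t \<Longrightarrow> x \<le> y \<Longrightarrow> tdep y t"
  by (meson agree_mono tdep_def)

lemma upd_simps [simp]:
  "upd f [] as = f" "upd f ys [] = f"
  "upd f (y # ys) (a # as) = upd (f(y := a)) ys as"
  by (cases ys; simp add: upd_def)+

lemma agree_upd: "agree x f g \<Longrightarrow> agree x (upd f ys as) (upd g ys as)"
proof (induction ys arbitrary: f g as)
  case (Cons y ys)
  then show ?case by (cases as) (auto intro: agree_fun_upd)
qed simp

lemma upd_notin: "v \<notin> set ys \<Longrightarrow> upd f ys as v = f v"
proof (induction ys arbitrary: f as)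
  case (Cons y ys)
  then show ?case by (cases as) auto
qed simp

lemma map_upd: "distinct ys \<Longrightarrow> length as = length ys \<Longrightarrow> map (upd f ys as) ys = as"
proof (induction ys arbitrary: f as)
  case (Cons y ys)
  then show ?case by (cases as) (auto simp: upd_notin)
qed simp

section \<open>Syntactic bounds on the variables of the input\<close>

primrec tm_below :: "nat \<Rightarrow> tm \<Rightarrow> bool" where
  "tm_below x (Var v) \<longleftrightarrow> v < x"
| "tm_below x (Const c) \<longleftrightarrow> True"
| "tm_below x (Add s t) \<longleftrightarrow> tm_below x s \<and> tm_below x t"
| "tm_below x (Mul a t) \<longleftrightarrow> tm_below x t"

text \<open>Bound variables are restricted as well, so that fresh variables differ from every
  variable that the input quantifies.\<close>

primrec fm_below :: "nat \<Rightarrow> fm \<Rightarrow> bool" where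
  "fm_below x (Less s t) \<longleftrightarrow> tm_below x s \<and> tm_below x t"
| "fm_below x (CongAt k s t) \<longleftrightarrow> tm_below x s \<and> tm_below x t"
| "fm_below x (Neg \<phi>) \<longleftrightarrow> fm_below x \<phi>"
| "fm_below x (Conj \<phi> \<psi>) \<longleftrightarrow> fm_below x \<phi> \<and> fm_below x \<psi>"
| "fm_below x (Disj \<phi> \<psi>) \<longleftrightarrow> fm_below x \<phi> \<and> fm_below x \<psi>"
| "fm_below x (Impl \<phi> \<psi>) \<longleftrightarrow> fm_below x \<phi> \<and> fm_below x \<psi>"
| "fm_below x (Equiv \<phi> \<psi>) \<longleftrightarrow> fm_below x \<phi> \<and> fm_below x \<psi>"
| "fm_below x (Ex y \<phi>) \<longleftrightarrow> y < x \<and> fm_below x \<phi>"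
| "fm_below x (ExMod t p ys \<phi>) \<longleftrightarrow> tm_below x t \<and> (\<forall>y\<in>set ys. y < x) \<and> fm_below x \<phi>"
| "fm_below x (ExGe c ys \<phi>) \<longleftrightarrow> (\<forall>y\<in>set ys. y < x) \<and> fm_below x \<phi>"
| "fm_below x (ExEq c ys \<phi>) \<longleftrightarrow> (\<forall>y\<in>set ys. y < x) \<and> fm_below x \<phi>"

lemma tm_below_tdep: "tm_below x t \<Longrightarrow> tdep x t"
proof (induction t)
  case (Add s t)
  then have "tdep x s" "tdep x t" by auto
  then show ?case by (auto simp: tdep_def intro!: arg_cong2[of _ _ _ _ "(+)"])
qed (auto simp: tdep_def agree_def)

lemma fm_below_dep: "fm_below x \<phi> \<Longrightarrow> dep x \<phi>"
proof (induction \<phi>)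
  case (Less s t)
  then show ?case by (auto simp: dep_def dest!: tm_below_tdep tdepD)
next
  case (CongAt k s t)
  then show ?case by (auto simp: dep_def dest!: tm_below_tdep tdepD)
next
  case (Ex y \<phi>)
  then show ?case by (auto simp: dep_def intro: agree_fun_upd)
next
  case (ExMod t p ys \<phi>)
  show ?case unfolding dep_def
  proof (intro allI impI)
    fix f g assume "agree x f g"
    then have "sat (upd f ys as) \<phi> = sat (upd g ys as) \<phi>" for as
      using ExMod by (intro depD[OF _ agree_upd]) auto
    moreover have "tval f t = tval g t"
      using ExMod.prems \<open>agree x f g\<close> by (auto intro: tdepD tm_below_tdep)
    ultimately show "sat f (ExMod t p ys \<phi>) = sat g (ExMod t p ys \<phi>)" by simp
  qed
next
  case (ExGe c ys \<phi>)
  show ?case unfolding dep_def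
  proof (intro allI impI)
    fix f g assume "agree x f g"
    then have "sat (upd f ys as) \<phi> = sat (upd g ys as) \<phi>" for as
      using ExGe by (intro depD[OF _ agree_upd]) auto
    then show "sat f (ExGe c ys \<phi>) = sat g (ExGe c ys \<phi>)" by simp
  qed
next
  case (ExEq c ys \<phi>)
  show ?case unfolding dep_def
  proof (intro allI impI)
    fix f g assume "agree x f g"
    then have "sat (upd f ys as) \<phi> = sat (upd g ys as) \<phi>" for as
      using ExEq by (intro depD[OF _ agree_upd]) auto
    then show "sat f (ExEq c ys \<phi>) = sat g (ExEq c ys \<phi>)" by simp
  qed
qed (auto simp: dep_def)

section \<open>Solution sets and blocks of existential quantifiers\<close>

definition sols :: "(nat \<Rightarrow> int) \<Rightarrow> nat list \<Rightarrow> fm \<Rightarrow> int list set" where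
  "sols f ys \<phi> = {as. length as = length ys \<and> sat (upd f ys as) \<phi>}"

lemma sols_agree: "dep x \<phi> \<Longrightarrow> agree x f g \<Longrightarrow> sols f ys \<phi> = sols g ys \<phi>"
  using depD[OF _ agree_upd] by (auto simp: sols_def)

lemma sols_Nil: "sols f [] \<phi> = (if sat f \<phi> then {[]} else {})"
  by (auto simp: sols_def)

lemma Cons_in_sols: "a # as \<in> sols f (y # ys) \<phi> \<longleftrightarrow> as \<in> sols (f(y := a)) ys \<phi>"
  by (auto simp: sols_def)

lemma in_sols_Cons: "bs \<in> sols f (y # ys) \<phi> \<Longrightarrow> \<exists>a as. bs = a # as"
  by (cases bs) (auto simp: sols_def)

primrec exists_fm :: "nat list \<Rightarrow> fm \<Rightarrow> fm" where
  "exists_fm [] \<phi> = \<phi>"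
| "exists_fm (y # ys) \<phi> = Ex y (exists_fm ys \<phi>)"

lemma sat_exists_fm: "sat f (exists_fm ys \<phi>) \<longleftrightarrow> sols f ys \<phi> \<noteq> {}"
proof (induction ys arbitrary: f)
  case (Cons y ys)
  have "sols f (y # ys) \<phi> \<noteq> {} \<longleftrightarrow> (\<exists>a as. a # as \<in> sols f (y # ys) \<phi>)"
    using in_sols_Cons by blast
  then have "sols f (y # ys) \<phi> \<noteq> {} \<longleftrightarrow> (\<exists>a. sols (f(y := a)) ys \<phi> \<noteq> {})"
    unfolding Cons_in_sols by blast
  with Cons show ?case by (simp add: fun_upd_def)
qed (simp add: sols_Nil)

section \<open>Threshold counting\<close>

definition atleast :: "nat \<Rightarrow> 'a set \<Rightarrow> bool" where
  "atleast c W \<longleftrightarrow> infinite W \<or> c \<le> card W"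

text \<open>Witnessing finite subsets treat finite and infinite \<open>W\<close> alike. Ranks are
  then taken only in finite sets, although the lexicographic order on integer tuples is not
  well-founded.\<close>

lemma atleast_subset: "atleast c W \<longleftrightarrow> (\<exists>F\<subseteq>W. finite F \<and> card F = c)"
proof
  assume "atleast c W"
  then show "\<exists>F\<subseteq>W. finite F \<and> card F = c"
    unfolding atleast_def by (metis infinite_arbitrarily_large obtain_subset_with_card_n)
next
  assume "\<exists>F\<subseteq>W. finite F \<and> card F = c"
  then show "atleast c W" unfolding atleast_def using card_mono by blast
qed

text \<open>Remove the maximum: it has the last rank, and no other rank changes.\<close>

lemma exists_rank:
  fixes F :: "'a :: linorder set"
  shows "finite F \<Longrightarrow> c < card F \<Longrightarrow> \<exists>x\<in>F. card {w\<in>F. w < x} = c"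
proof (induction "card F" arbitrary: F)
  case (Suc n)
  let ?m = "Max F"
  from Suc have F: "F \<noteq> {}" "finite F" by auto
  then have m: "?m \<in> F" by simp
  have n: "n = card (F - {?m})" using Suc.hyps(2) m F by simp
  show ?case
  proof (cases "c = n")
    case True
    have "{w\<in>F. w < ?m} = F - {?m}" using F by (auto simp: order.strict_iff_order)
    with True n m show ?thesis by (intro bexI[of _ ?m]) auto
  next
    case False
    then have "c < card (F - {?m})" using Suc.prems Suc.hyps(2) n by simp
    with Suc.hyps(1)[OF n] F obtain x where x: "x \<in> F" "x \<noteq> ?m" "card {w\<in>F - {?m}. w < x} = c"
      by auto
    have "x \<le> ?m" using x(1) F(2) by simp
    then have "{w\<in>F - {?m}. w < x} = {w\<in>F. w < x}" by auto
    with x show ?thesis by auto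
  qed
qed simp

text \<open>The pivot is the element of rank \<open>c div 2\<close> in a subset of size
  \<open>c\<close>. For odd \<open>c\<close> it separates two halves of that size; for even
  \<open>c\<close> it must itself be counted in the upper half, hence the weaker condition there.
  Conversely the halves are disjoint, and for odd \<open>c\<close> the pivot supplies the missing
  element.\<close>

lemma atleast_halve:
  fixes W :: "'a :: linorder set"
  assumes "0 < c"
  shows "atleast c W \<longleftrightarrow> (\<exists>x\<in>W. atleast (c div 2) {w\<in>W. w < x} \<and>
    atleast (c div 2) {w\<in>W. if odd c then x < w else \<not> w < x})" (is "_ \<longleftrightarrow> ?R")
proof
  assume "atleast c W"
  then obtain F where F: "F \<subseteq> W" "finite F" "card F = c" by (auto simp: atleast_subset)
  with exists_rank[of F "c div 2"] assms obtain x where x: "x \<in> F" "card {w\<in>F. w < x} = c div 2"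
    by auto
  have "F = insert x ({w\<in>F. w < x} \<union> {w\<in>F. x < w})" using x(1) by auto
  then have "card F = card (insert x ({w\<in>F. w < x} \<union> {w\<in>F. x < w}))" by simp
  also have "\<dots> = 1 + (c div 2 + card {w\<in>F. x < w})"
    using F(2) x(2) by (subst card_insert_disjoint, simp_all) (subst card_Un_disjoint, auto)
  finally have u: "card {w\<in>F. x < w} + 1 + c div 2 = c" using F(3) by simp
  have "{w\<in>F. \<not> w < x} = insert x {w\<in>F. x < w}" using x(1) by auto
  then have u': "card {w\<in>F. \<not> w < x} + c div 2 = c" using u F(2) by simp
  have 1: "atleast (c div 2) {w\<in>W. w < x}"
    unfolding atleast_subset using F x by (intro exI[of _ "{w\<in>F. w < x}"]) auto
  have 2: "atleast (c div 2) {w\<in>W. if odd c then x < w else \<not> w < x}"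
    unfolding atleast_subset
  proof (intro exI[of _ "{w\<in>F. if odd c then x < w else \<not> w < x}"] conjI)
    show "card {w \<in> F. if odd c then x < w else \<not> w < x} = c div 2"
    proof (cases "odd c")
      case True
      then show ?thesis using u by simp presburger
    next
      case False
      then show ?thesis using u' by simp presburger
    qed
  qed (use F in auto)
  from 1 2 x(1) F(1) show ?R by blast
next
  assume ?R
  then obtain x A B where x: "x \<in> W" and A: "A \<subseteq> {w\<in>W. w < x}" "finite A" "card A = c div 2"
    and B: "B \<subseteq> {w\<in>W. if odd c then x < w else \<not> w < x}" "finite B" "card B = c div 2"
    by (auto simp: atleast_subset)
  have disj: "A \<inter> B = {}" "x \<notin> A" using A(1) B(1) by (fastforce split: if_splits)+
  show "atleast c W"
  proof (cases "odd c")
    case True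
    then have "x \<notin> B" using B(1) by auto
    have "card (insert x (A \<union> B)) = 1 + (c div 2 + c div 2)"
      using A(2,3) B(2,3) disj \<open>x \<notin> B\<close> by (simp add: card_Un_disjoint)
    also have "\<dots> = c" using True by presburger
    finally show ?thesis unfolding atleast_subset using x A B
      by (intro exI[of _ "insert x (A \<union> B)"]) (auto split: if_splits)
  next
    case False
    have "card (A \<union> B) = c div 2 + c div 2"
      using A(2,3) B(2,3) disj by (simp add: card_Un_disjoint)
    also have "\<dots> = c" using False by presburger
    finally show ?thesis unfolding atleast_subset using A B
      by (intro exI[of _ "A \<union> B"]) (auto split: if_splits)
  qed
qed

text \<open>Fresh variables are taken from the sequence \<open>x\<close>, \<open>2 * x + 1\<close>, \<dots>, since the program
  computes the next one by putting a single digit in front.\<close>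

abbreviation next_var :: "nat \<Rightarrow> nat" where
  "next_var x \<equiv> 2 * x + 1"

primrec fresh_vars :: "nat list \<Rightarrow> nat \<Rightarrow> nat list" where
  "fresh_vars [] x = []"
| "fresh_vars (y # ys) x = x # fresh_vars ys (next_var x)"

primrec var_after :: "nat list \<Rightarrow> nat \<Rightarrow> nat" where
  "var_after [] x = x"
| "var_after (y # ys) x = var_after ys (next_var x)"

lemma var_after_ge: "x \<le> var_after ys x"
proof (induction ys arbitrary: x)
  case (Cons y ys)
  from Cons[of "next_var x"] show ?case by simp
qed simp

lemma fresh_vars:
  "length (fresh_vars ys x) = length ys"
  "v \<in> set (fresh_vars ys x) \<Longrightarrow> x \<le> v \<and> v < var_after ys x"
  "distinct (fresh_vars ys x)"
proof (induction ys arbitrary: x v)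
  case (Cons y ys)
  {
    case 1 show ?case using Cons by simp
  next
    case 2 then show ?case using Cons(2)[where x = "next_var x"] var_after_ge[of "next_var x" ys] by fastforce
  next
    case 3 then show ?case using Cons(2)[where x = "next_var x" and v = x] Cons(3) by auto
  }
qed simp_all

section \<open>Lexicographic comparison and the threshold formula\<close>

definition true_fm :: fm where
  "true_fm = CongAt 1 (Const 0) (Const 0)"

fun lex_less_fm :: "nat list \<Rightarrow> nat list \<Rightarrow> fm" where
  "lex_less_fm (y # ys) (x # xs) =
     Disj (Less (Var y) (Var x)) (Conj (Neg (Less (Var x) (Var y))) (lex_less_fm ys xs))"
| "lex_less_fm _ _ = Neg true_fm"

lemma sat_true_fm [simp]: "sat f true_fm"
  by (simp add: true_fm_def)

lemma sat_lex_less_fm: "length ys = length xs \<Longrightarrow> sat f (lex_less_fm ys xs) \<longleftrightarrow> map f ys < map f xs"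
  by (induction ys xs rule: lex_less_fm.induct) auto

text \<open>The fresh tuple \<open>xs\<close> holds the pivot. That it lies in \<open>W\<close> is
  said by quantifying \<open>ys\<close> again under lexicographic equality with \<open>xs\<close>,
  so \<open>\<psi>\<close> never has to be renamed. The restrictions to one side of a pivot
  accumulate as conjuncts of \<open>\<psi>\<close>.\<close>

fun threshold_fm :: "nat \<Rightarrow> nat list \<Rightarrow> nat \<Rightarrow> fm \<Rightarrow> fm" where
  "threshold_fm c ys x \<psi> = (if c = 0 then true_fm else
     let xs = fresh_vars ys x; x' = var_after ys x in
     exists_fm xs (Conj (exists_fm ys (Conj (Neg (lex_less_fm ys xs)) (Conj (Neg (lex_less_fm xs ys)) \<psi>)))
       (Conj (threshold_fm (c div 2) ys x' (Conj (lex_less_fm ys xs) \<psi>))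
         (threshold_fm (c div 2) ys x' (Conj (if odd c then lex_less_fm xs ys else Neg (lex_less_fm ys xs)) \<psi>)))))"

declare threshold_fm.simps [simp del]

lemma threshold_fm_0 [simp]: "threshold_fm 0 ys x \<psi> = true_fm"
  by (simp add: threshold_fm.simps)

lemma sat_threshold_fm:
  assumes "distinct ys" "\<And>y. y \<in> set ys \<Longrightarrow> y < x" "dep x \<psi>"
  shows "sat f (threshold_fm c ys x \<psi>) \<longleftrightarrow> atleast c (sols f ys \<psi>)"
  using assms
proof (induction c arbitrary: f x \<psi> rule: less_induct)
  case (less c)
  show ?case
  proof (cases "c = 0")
    case True
    then show ?thesis by (simp add: atleast_def)
  next
    case False
    let ?xs = "fresh_vars ys x" and ?x' = "var_after ys x" and ?W = "sols f ys \<psi>"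
    have lt: "v < ?x'" if "v \<in> set ys \<or> v \<in> set ?xs" for v
      using that less.prems(2) fresh_vars(2) var_after_ge by (meson order_less_le_trans)
    have dep_lex_less_fm: "dep ?x' (lex_less_fm us vs)"
      if "length us = length vs" "set us \<union> set vs \<subseteq> set ys \<union> set ?xs" for us vs
      unfolding dep_def
    proof (intro allI impI)
      fix f g assume "agree ?x' f g"
      then have "map f us = map g us" "map f vs = map g vs"
        using that(2) lt by (auto simp: agree_def simp del: map_eq_conv intro!: map_cong)
      then show "sat f (lex_less_fm us vs) = sat g (lex_less_fm us vs)" using that(1) by (simp add: sat_lex_less_fm del: map_eq_conv)
    qed
    have dep: "dep ?x' (Conj (lex_less_fm ys ?xs) \<psi>)" "dep ?x' (Conj (lex_less_fm ?xs ys) \<psi>)"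
      "dep ?x' (Conj (Neg (lex_less_fm ys ?xs)) \<psi>)"
      using dep_lex_less_fm[of ys ?xs] dep_lex_less_fm[of ?xs ys] dep_mono[OF less.prems(3) var_after_ge[of x ys]]
      by (auto simp: fresh_vars(1) dep_def)
    \<comment> \<open>Once \<open>xs\<close> is set to \<open>bs\<close>, a formula relating
      \<open>ys\<close> and \<open>xs\<close> is a condition on single solutions:
      \<open>\<psi>\<close> does not see \<open>xs\<close>, and assigning \<open>ys\<close> leaves
      \<open>xs\<close> alone.\<close>
    have sat_upd: "sols (upd f ?xs bs) ys (Conj \<chi> \<psi>) = {as\<in>?W. Q as}"
      if bs: "length bs = length ys"
        and \<chi>: "\<And>g. map g ?xs = bs \<Longrightarrow> sat g \<chi> \<longleftrightarrow> Q (map g ys)" for bs \<chi> Q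
    proof -
      have 1: "agree x (upd f ?xs bs) f"
        using fresh_vars(2)[of _ ys x] by (force simp: agree_def intro!: upd_notin)
      have 2: "map (upd (upd f ?xs bs) ys as) ?xs = bs" for as
      proof -
        have "map (upd (upd f ?xs bs) ys as) ?xs = map (upd f ?xs bs) ?xs"
          using fresh_vars(2)[of _ ys x] less.prems(2) by (force intro!: upd_notin)
        then show ?thesis using map_upd[OF fresh_vars(3)] bs by (simp add: fresh_vars(1))
      qed
      have "sat (upd (upd f ?xs bs) ys as) \<psi> = sat (upd f ys as) \<psi>" for as
        by (rule depD[OF less.prems(3) agree_upd[OF 1]])
      then show ?thesis
        using \<chi>[OF 2] map_upd[OF less.prems(1)] by (auto simp: sols_def)
    qed
    have low: "sols (upd f ?xs bs) ys (Conj (lex_less_fm ys ?xs) \<psi>) = {as\<in>?W. as < bs}"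
      and high: "sols (upd f ?xs bs) ys (Conj (lex_less_fm ?xs ys) \<psi>) = {as\<in>?W. bs < as}"
      and nlow: "sols (upd f ?xs bs) ys (Conj (Neg (lex_less_fm ys ?xs)) \<psi>) = {as\<in>?W. \<not> as < bs}"
      if "length bs = length ys" for bs
      by (rule sat_upd[OF that], simp add: sat_lex_less_fm fresh_vars(1))+
    have eqs: "sols (upd f ?xs bs) ys (Conj (Neg (lex_less_fm ys ?xs)) (Conj (Neg (lex_less_fm ?xs ys)) \<psi>)) =
        {as\<in>?W. as = bs}" if "length bs = length ys" for bs
    proof -
      have "sols (upd f ?xs bs) ys (Conj (Neg (lex_less_fm ys ?xs)) (Conj (Neg (lex_less_fm ?xs ys)) \<psi>)) =
          sols (upd f ?xs bs) ys (Conj (Conj (Neg (lex_less_fm ys ?xs)) (Neg (lex_less_fm ?xs ys))) \<psi>)"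
        by (auto simp: sols_def)
      also have "\<dots> = {as\<in>?W. as = bs}"
        by (rule sat_upd[OF that]) (auto simp: sat_lex_less_fm fresh_vars(1))
      finally show ?thesis .
    qed
    have IH: "sat g (threshold_fm (c div 2) ys ?x' \<chi>) \<longleftrightarrow> atleast (c div 2) (sols g ys \<chi>)"
      if "dep ?x' \<chi>" for g \<chi>
      using less.IH[of "c div 2" ?x' \<chi> g] False less.prems(1) lt that by auto
    have "sat f (threshold_fm c ys x \<psi>) \<longleftrightarrow> (\<exists>bs. length bs = length ys \<and> bs \<in> ?W \<and>
        atleast (c div 2) {as\<in>?W. as < bs} \<and>
        atleast (c div 2) {as\<in>?W. if odd c then bs < as else \<not> as < bs})"
      using False
      by (cases "odd c")
        (auto simp: threshold_fm.simps[of c] sat_exists_fm sols_def[of _ ?xs] fresh_vars(1) IH dep low high nlow eqs Let_def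
          cong: conj_cong)
    also have "\<dots> \<longleftrightarrow> atleast c ?W"
      using False by (subst (3) atleast_halve) (auto simp: sols_def)
    finally show ?thesis .
  qed
qed

section \<open>Modulo counting\<close>

abbreviation Num :: "nat \<Rightarrow> tm" where
  "Num m \<equiv> Const (int m)"

text \<open>The residue \<open>t\<close> is replaced by a constant \<open>i < 2 ^ k\<close>. With \<open>2 ^ k \<ge> p\<close> all residues
  are covered, and repetitions are harmless in a disjunction.\<close>

primrec residue_fm :: "nat \<Rightarrow> nat \<Rightarrow> tm \<Rightarrow> nat \<Rightarrow> nat \<Rightarrow> fm \<Rightarrow> fm" where
  "residue_fm 0 m t p y \<psi> = Conj (CongAt p t (Num m)) (ExMod (Num m) p [y] \<psi>)"
| "residue_fm (Suc k) m t p y \<psi> = Disj (residue_fm k (2 * m) t p y \<psi>) (residue_fm k (2 * m + 1) t p y \<psi>)"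

lemma bits_0 [simp]: "bits 0 = []"
  by (simp add: bits.simps)

lemma bits_pos: "0 < n \<Longrightarrow> bits n = odd n # bits (n div 2)"
  by (simp add: bits.simps[of n])

lemma less_power_bits: "n < 2 ^ length (bits n)"
proof (induction n rule: less_induct)
  case (less n)
  show ?case
  proof (cases "n = 0")
    case False
    then have "n div 2 < 2 ^ length (bits (n div 2))" using less by simp
    then show ?thesis using False by (simp add: bits_pos)
  qed simp
qed

lemma dyadic_split:
  "{j * 2 ^ Suc k ..< (j + 1) * 2 ^ Suc k} =
    {2 * j * 2 ^ k ..< (2 * j + 1) * 2 ^ k} \<union> {(2 * j + 1) * 2 ^ k ..< (2 * j + 1 + 1) * 2 ^ k :: nat}"
  by (subst ivl_disj_un_two(3)) (simp_all add: algebra_simps)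

lemma sat_residue_fm: "sat f (residue_fm k m t p y \<psi>) \<longleftrightarrow>
  (\<exists>i\<in>{m * 2 ^ k ..< (m + 1) * 2 ^ k}.
    [tval f t = int i] (mod int p) \<and> sat f (ExMod (Num i) p [y] \<psi>))"
proof (induction k arbitrary: m)
  case 0
  have "{m * 2 ^ 0 ..< (m + 1) * 2 ^ 0} = {m}" by auto
  then show ?case by (simp only: residue_fm.simps sat.simps(2,4) tval.simps bex_simps(5) bex_empty simp_thms)
next
  case (Suc k)
  show ?case unfolding residue_fm.simps sat.simps(5) Suc.IH dyadic_split[of m k] bex_Un ..
qed

lemma sols_single: "sols f [y] \<psi> = (\<lambda>a. [a]) ` {a. sat (f(y := a)) \<psi>}"
  by (force simp: sols_def length_Suc_conv)

lemma sat_ExMod: "sat f (ExMod t p ys \<psi>) \<longleftrightarrow>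
    finite (sols f ys \<psi>) \<and> [int (card (sols f ys \<psi>)) = tval f t] (mod int p)"
  unfolding sols_def sat.simps Let_def ..

lemma sat_residue_fm_bits:
  assumes "0 < p" "A = {a. sat (f(y := a)) \<psi>}"
  shows "sat f (residue_fm (length (bits p)) 0 t p y \<psi>) \<longleftrightarrow>
    finite A \<and> [tval f t = int (card A)] (mod int p)"
proof -
  have inj: "inj_on (\<lambda>a. [a]) A" by (rule inj_onI) simp
  have s: "sat f (ExMod (Num i) p [y] \<psi>) \<longleftrightarrow> finite A \<and> [int (card A) = int i] (mod int p)" for i
    unfolding sat_ExMod sols_single assms(2)[symmetric]
    by (simp add: finite_image_iff[OF inj] card_image[OF inj])
  obtain i where i: "i < p" "[tval f t = int i] (mod int p)"
    using assms(1) by (intro that[of "nat (tval f t mod int p)"]) (auto simp: nat_less_iff cong_def)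
  show ?thesis
  proof
    assume "sat f (residue_fm (length (bits p)) 0 t p y \<psi>)"
    then obtain i where "finite A" "[tval f t = int i] (mod int p)" "[int (card A) = int i] (mod int p)"
      unfolding sat_residue_fm s by blast
    then show "finite A \<and> [tval f t = int (card A)] (mod int p)"
      using cong_trans[OF _ cong_sym] by blast
  next
    assume A: "finite A \<and> [tval f t = int (card A)] (mod int p)"
    then have "[int (card A) = int i] (mod int p)" using cong_trans[OF cong_sym i(2)] by blast
    moreover have "i < 2 ^ length (bits p)" using i(1) less_power_bits[of p] by linarith
    ultimately show "sat f (residue_fm (length (bits p)) 0 t p y \<psi>)"
      unfolding sat_residue_fm s using A i(2) by (intro bexI[of _ i]) auto
  qed
qed

text \<open>The leaves of the tree are the \<open>j < 2 ^ length (bits p)\<close>; those with \<open>j \<ge> p\<close> would count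
  residues twice.\<close>

primrec sum_fm :: "nat \<Rightarrow> nat \<Rightarrow> tm \<Rightarrow> nat \<Rightarrow> nat \<Rightarrow> nat \<Rightarrow> fm \<Rightarrow> (nat \<Rightarrow> nat \<Rightarrow> fm) \<Rightarrow> fm" where
  "sum_fm 0 j s x p y E \<mu> =
     (if j < p
      then Ex x (Conj
        (residue_fm (length (bits p)) 0 (Var x) p y (Conj E (\<mu> j (next_var x))))
        (CongAt p s (Mul (int j) (Var x))))
      else CongAt p s (Num 0))"
| "sum_fm (Suc k) j s x p y E \<mu> =
     Ex x (Conj
       (sum_fm k (2 * j) (Var x) (next_var x) p y E \<mu>)
       (sum_fm k (2 * j + 1) (Add s (Mul (- 1) (Var x))) (next_var x) p y E \<mu>))"

lemma sat_Ex: "sat f (Ex y \<phi>) \<longleftrightarrow> (\<exists>a. sat (f(y := a)) \<phi>)"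
  by (simp add: fun_upd_def)

text \<open>The groups \<open>A i\<close> must not change with the guesses made so far. Assumption
  \<open>A\<close> ensures this: \<open>x0\<close> is at most every guessed variable, and
  \<open>x\<close> is the next one to guess.\<close>

lemma sat_sum_fm:
  assumes "0 < p"
    and A: "\<And>g i x. agree x0 g f \<Longrightarrow> x0 \<le> x \<Longrightarrow> {a. sat (g(y := a)) (Conj E (\<mu> i x))} = A i"
  shows "agree x0 g f \<Longrightarrow> x0 \<le> x \<Longrightarrow> tdep x s \<Longrightarrow>
    sat g (sum_fm k j s x p y E \<mu>) \<longleftrightarrow>
    (\<forall>i\<in>{j * 2 ^ k ..< (j + 1) * 2 ^ k} \<inter> {..<p}. finite (A i)) \<and>
    [tval g s = (\<Sum>i\<in>{j * 2 ^ k ..< (j + 1) * 2 ^ k} \<inter> {..<p}. int i * int (card (A i)))] (mod int p)"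
proof (induction k arbitrary: j s x g)
  case 0
  have ag: "agree x0 (g(x := z)) f" for z
    using 0 by (auto simp: agree_def)
  have ts: "tval (g(x := z)) s = tval g s" for z
    using tdepD[OF 0(3) agree_fun_upd_fresh[OF order_refl]] .
  show ?case
  proof (cases "j < p")
    case True
    have x: "x0 \<le> next_var x" using 0(2) by simp
    have "sat g (sum_fm 0 j s x p y E \<mu>) \<longleftrightarrow>
        (\<exists>z. finite (A j) \<and> [z = int (card (A j))] (mod int p) \<and> [tval g s = int j * z] (mod int p))"
      using True 0(2)
      unfolding sum_fm.simps if_P[OF True] sat_Ex sat.simps(4) sat_residue_fm_bits[OF assms(1) A[OF ag x, symmetric]]
      by (auto simp: ts)
    \<comment> \<open>The guess is determined modulo \<open>p\<close>; the cardinality itself is a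
      valid one.\<close>
    also have "\<dots> \<longleftrightarrow> finite (A j) \<and> [tval g s = int j * int (card (A j))] (mod int p)"
      using cong_refl[of "int (card (A j))"] cong_trans[OF _ cong_scalar_left] by blast
    also have "{j * 2 ^ 0 ..< (j + 1) * 2 ^ 0} \<inter> {..<p} = {j}" using True by auto
    ultimately show ?thesis by simp
  next
    case False
    then have "{j * 2 ^ 0 ..< (j + 1) * 2 ^ 0} \<inter> {..<p} = {}" by auto
    with False show ?thesis by simp
  qed
next
  case (Suc k)
  have ag: "agree x0 (g(x := z)) f" for z
    using Suc.prems by (auto simp: agree_def)
  have ts: "tval (g(x := z)) s = tval g s" for z
    using tdepD[OF Suc.prems(3) agree_fun_upd_fresh[OF order_refl]] .
  let ?I = "\<lambda>j k. {j * 2 ^ k ..< (j + 1) * 2 ^ k} \<inter> {..<p}"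
  let ?S = "\<lambda>J. \<Sum>i\<in>J. int i * int (card (A i))"
  have I: "?I j (Suc k) = ?I (2 * j) k \<union> ?I (2 * j + 1) k"
    unfolding dyadic_split Int_Un_distrib2 ..
  have S: "?S (?I j (Suc k)) = ?S (?I (2 * j) k) + ?S (?I (2 * j + 1) k)"
    unfolding I by (rule sum.union_disjoint) auto
  have td: "tdep (next_var x) (Var x)" "tdep (next_var x) (Add s (Mul (- 1) (Var x)))"
    using tdep_mono[OF Suc.prems(3), of "next_var x"] by (auto simp: tdep_def agree_def)
  have x: "x0 \<le> next_var x" using Suc.prems(2) by simp
  have "sat g (sum_fm (Suc k) j s x p y E \<mu>) \<longleftrightarrow> (\<exists>z.
      ((\<forall>i\<in>?I (2 * j) k. finite (A i)) \<and> [z = ?S (?I (2 * j) k)] (mod int p)) \<and>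
      ((\<forall>i\<in>?I (2 * j + 1) k. finite (A i)) \<and> [tval g s - z = ?S (?I (2 * j + 1) k)] (mod int p)))"
    unfolding sum_fm.simps sat_Ex sat.simps(4) Suc.IH[OF ag x td(1)] Suc.IH[OF ag x td(2)]
    by (simp add: ts)
  also have "\<dots> \<longleftrightarrow> (\<forall>i\<in>?I j (Suc k). finite (A i)) \<and>
      [tval g s = ?S (?I (2 * j) k) + ?S (?I (2 * j + 1) k)] (mod int p)"
  proof -
    \<comment> \<open>Guesses range over all integers and matter only modulo \<open>p\<close>; the
      left sum itself serves as witness.\<close>
    have "(\<exists>z. [z = a] (mod int p) \<and> [u - z = b] (mod int p)) \<longleftrightarrow> [u = a + b] (mod int p)" for a b u
    proof
      assume "\<exists>z. [z = a] (mod int p) \<and> [u - z = b] (mod int p)"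
      then obtain z where "[z = a] (mod int p)" "[u - z = b] (mod int p)" by blast
      from cong_add[OF this] show "[u = a + b] (mod int p)" by simp
    next
      assume "[u = a + b] (mod int p)"
      from cong_diff[OF this cong_refl[of a]] have "[u - a = b] (mod int p)" by simp
      then show "\<exists>z. [z = a] (mod int p) \<and> [u - z = b] (mod int p)" by (intro exI[of _ a]) simp
    qed
    from this[of "?S (?I (2 * j) k)" "tval g s" "?S (?I (2 * j + 1) k)"]
    show ?thesis unfolding I by blast
  qed
  finally show ?case unfolding S .
qed

text \<open>Empty slices are left out, for otherwise the group \<open>A 0\<close> would be infinite.\<close>

lemma card_slices:
  fixes S :: "int \<Rightarrow> int list set"
  assumes p: "0 < p"
    and W: "W = (\<Union>a. (#) a ` S a)"
    and A: "\<And>i. A i = {a. S a \<noteq> {} \<and> finite (S a) \<and> [int (card (S a)) = int i] (mod int p)}"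
  shows "finite W \<and> [int (card W) = u] (mod int p) \<longleftrightarrow>
    (\<forall>a. finite (S a)) \<and> (\<forall>i<p. finite (A i)) \<and>
    [u = (\<Sum>i<p. int i * int (card (A i)))] (mod int p)"
proof -
  let ?N = "{a. S a \<noteq> {}}"
  have finite_slices: "finite (S a)" if "finite W" for a
  proof -
    have "(#) a ` S a \<subseteq> W" using W by auto
    then show ?thesis using that finite_subset by (blast dest: finite_imageD[OF _ inj_onI])
  qed
  \<comment> \<open>This turns the finiteness of the finitely many \<open>A i\<close> into that of
    the set of nonempty slices.\<close>
  have N: "?N = (\<Union>i<p. A i)" if "\<And>a. finite (S a)"
  proof -
    have "\<exists>i<p. [int (card (S a)) = int i] (mod int p)" for a
      using p by (intro exI[of _ "card (S a) mod p"]) (simp add: cong_def zmod_int)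
    with that show ?thesis by (auto simp: A)
  qed
  have finite_W: "finite W \<longleftrightarrow> (\<forall>a. finite (S a)) \<and> (\<forall>i<p. finite (A i))"
  proof
    assume fin: "finite W"
    have "?N \<subseteq> hd ` W"
    proof
      fix a assume "a \<in> ?N"
      then obtain as where "as \<in> S a" by auto
      then have "a # as \<in> W" using W by auto
      then show "a \<in> hd ` W" by force
    qed
    then have "finite ?N" using fin finite_subset by blast
    then show "(\<forall>a. finite (S a)) \<and> (\<forall>i<p. finite (A i))"
      using finite_slices[OF fin] N by (auto simp: finite_subset)
  next
    assume *: "(\<forall>a. finite (S a)) \<and> (\<forall>i<p. finite (A i))"
    then have "finite (\<Union>a\<in>?N. (#) a ` S a)" using N by auto
    moreover have "W = (\<Union>a\<in>?N. (#) a ` S a)" using W by auto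
    ultimately show "finite W" by simp
  qed
  have "[int (card W) = (\<Sum>i<p. int i * int (card (A i)))] (mod int p)" if "finite W"
  proof -
    note fin = finite_slices[OF that]
    have finA: "\<forall>i<p. finite (A i)" using that finite_W by blast
    have finN: "finite ?N" using N[OF fin] finA by auto
    have "W = (\<Union>a\<in>?N. (#) a ` S a)" using W by auto
    then have "card W = (\<Sum>a\<in>?N. card ((#) a ` S a))"
      using finN fin by (simp only:) (rule card_UN_disjoint, auto)
    also have "\<dots> = (\<Sum>a\<in>?N. card (S a))" by (intro sum.cong card_image inj_onI) auto
    also have "\<dots> = (\<Sum>i<p. \<Sum>a\<in>A i. card (S a))"
      unfolding N[OF fin]
    proof (rule sum.UNION_disjoint)
      show "\<forall>i\<in>{..<p}. \<forall>j\<in>{..<p}. i \<noteq> j \<longrightarrow> A i \<inter> A j = {}"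
      proof (intro ballI impI)
        fix i j assume "i \<in> {..<p}" "j \<in> {..<p}" "i \<noteq> j"
        then have "\<not> [int i = int j] (mod int p)" by (simp add: cong_int_iff cong_def)
        then show "A i \<inter> A j = {}" unfolding A using cong_trans[OF cong_sym] by blast
      qed
    qed (use finA in auto)
    finally have "int (card W) = (\<Sum>i<p. \<Sum>a\<in>A i. int (card (S a)))" by simp
    also have "[\<dots> = (\<Sum>i<p. \<Sum>a\<in>A i. int i)] (mod int p)"
      by (intro cong_sum) (auto simp: A)
    also have "(\<Sum>i<p. \<Sum>a\<in>A i. int i) = (\<Sum>i<p. int i * int (card (A i)))"
      by (simp add: mult.commute)
    finally show ?thesis .
  qed
  note card_W = this
  have "[int (card W) = u] (mod int p) \<longleftrightarrow> [u = (\<Sum>i<p. int i * int (card (A i)))] (mod int p)"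
    if "finite W"
    using cong_trans[OF cong_sym card_W[OF that]] cong_trans[OF card_W[OF that] cong_sym] cong_sym
    by metis
  with finite_W show ?thesis by blast
qed

text \<open>For the empty tuple there is at most one solution, so the cardinality is 1 or 0. In the
  step, a slice is finite iff its cardinality is congruent to some integer; the first conjunct says
  this for all slices. It cannot be left to \<open>sum_fm\<close>, because an infinite slice belongs
  to no group and would go unnoticed.\<close>

primrec mod_fm :: "nat list \<Rightarrow> tm \<Rightarrow> nat \<Rightarrow> fm \<Rightarrow> nat \<Rightarrow> fm" where
  "mod_fm [] t p \<phi> x =
     Disj (Conj \<phi> (CongAt p t (Num 1))) (Conj (Neg \<phi>) (CongAt p t (Num 0)))"
| "mod_fm (y # ys) t p \<phi> x =
     Conj (Neg (Ex y (Neg (Ex x (mod_fm ys (Var x) p \<phi> (next_var x))))))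
       (sum_fm (length (bits p)) 0 t x p y (exists_fm ys \<phi>) (\<lambda>j. mod_fm ys (Num j) p \<phi>))"

lemma sat_mod_fm:
  assumes p: "0 < p"
  shows "dep x \<phi> \<Longrightarrow> tdep x t \<Longrightarrow> (\<And>y. y \<in> set ys \<Longrightarrow> y < x) \<Longrightarrow>
    sat f (mod_fm ys t p \<phi> x) \<longleftrightarrow>
    finite (sols f ys \<phi>) \<and> [int (card (sols f ys \<phi>)) = tval f t] (mod int p)"
proof (induction ys arbitrary: f t x)
  case Nil
  show ?case by (auto simp: sols_Nil cong_sym_eq)
next
  case (Cons y ys)
  let ?S = "\<lambda>a. sols (f(y := a)) ys \<phi>"
  let ?A = "\<lambda>i. {a. ?S a \<noteq> {} \<and> finite (?S a) \<and> [int (card (?S a)) = int i] (mod int p)}"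
  have ys: "v < x'" if "v \<in> set ys" "x \<le> x'" for v x'
    using that Cons.prems(3)[of v] by simp
  have "tdep x' (Var z)" if "z < x'" for x' z using that by (auto simp: tdep_def agree_def)
  then have "sat (f(y := a)) (Ex x (mod_fm ys (Var x) p \<phi> (next_var x))) \<longleftrightarrow>
      (\<exists>z. finite (sols (f(y := a, x := z)) ys \<phi>) \<and>
        [int (card (sols (f(y := a, x := z)) ys \<phi>)) = z] (mod int p))" for a
    unfolding sat_Ex using ys
    by (subst Cons.IH[OF dep_mono[OF Cons.prems(1)]]) auto
  also have "\<dots> a \<longleftrightarrow> finite (?S a)" for a
  proof -
    \<comment> \<open>The guessed residue sits in a variable on which \<open>\<phi>\<close> does not
      depend; for a finite slice, its cardinality is a witness.\<close>
    have "sols (f(y := a, x := z)) ys \<phi> = ?S a" for z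
      by (rule sols_agree[OF Cons.prems(1) agree_fun_upd_fresh[OF order_refl]])
    then show ?thesis by (auto intro: cong_refl)
  qed
  finally have 1: "sat f (Neg (Ex y (Neg (Ex x (mod_fm ys (Var x) p \<phi> (next_var x)))))) \<longleftrightarrow>
      (\<forall>a. finite (?S a))"
    unfolding sat.simps(3) sat_Ex by blast
  have A: "{a. sat (g(y := a)) (Conj (exists_fm ys \<phi>) (mod_fm ys (Num i) p \<phi> x'))} = ?A i"
    if "agree x g f" "x \<le> x'" for g i x'
  proof -
    have "tdep x' (Num i)" by (simp add: tdep_def)
    moreover have "sols (g(y := a)) ys \<phi> = ?S a" for a
      by (rule sols_agree[OF Cons.prems(1) agree_fun_upd[OF that(1)]])
    ultimately show ?thesis
      using Cons.IH[OF dep_mono[OF Cons.prems(1) that(2)]] ys that(2) by (simp add: sat_exists_fm)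
  qed
  let ?J = "{0 * 2 ^ length (bits p) ..< (0 + 1) * 2 ^ length (bits p)} \<inter> {..<p}"
  have "agree x f f" by (simp add: agree_def)
  have 2: "sat f (sum_fm (length (bits p)) 0 t x p y (exists_fm ys \<phi>) (\<lambda>j. mod_fm ys (Num j) p \<phi>)) \<longleftrightarrow>
    (\<forall>i\<in>?J. finite (?A i)) \<and> [tval f t = (\<Sum>i\<in>?J. int i * int (card (?A i)))] (mod int p)"
    by (rule sat_sum_fm[where A = ?A and f = f and x0 = x];
        (rule p order_refl Cons.prems(2) \<open>agree x f f\<close> | (rule A; assumption)))
  have I: "?J = {..<p}"
    using less_power_bits[of p] by auto
  have W: "sols f (y # ys) \<phi> = (\<Union>a. (#) a ` ?S a)"
  proof (intro set_eqI iffI)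
    fix bs assume "bs \<in> sols f (y # ys) \<phi>"
    then obtain a as where "bs = a # as" "as \<in> ?S a" using in_sols_Cons Cons_in_sols by blast
    then show "bs \<in> (\<Union>a. (#) a ` ?S a)" by blast
  next
    fix bs assume "bs \<in> (\<Union>a. (#) a ` ?S a)"
    then obtain a as where "bs = a # as" "as \<in> ?S a" by blast
    then show "bs \<in> sols f (y # ys) \<phi>" by (simp only: Cons_in_sols)
  qed
  show ?case
    unfolding mod_fm.simps sat.simps(4) 1 2 I card_slices[where S = ?S and A = ?A, OF p W refl]
    by (simp only: Ball_def lessThan_iff)
qed

section \<open>The translation\<close>

text \<open>One \<open>x\<close> serves all levels. An inner translation may bind the same fresh
  variables again, since semantically it depends only on variables below \<open>x\<close>.\<close>

primrec translate_fm :: "nat \<Rightarrow> fm \<Rightarrow> fm" where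
  "translate_fm x (Less s t) = Less s t"
| "translate_fm x (CongAt k s t) = CongAt k s t"
| "translate_fm x (Neg \<phi>) = Neg (translate_fm x \<phi>)"
| "translate_fm x (Conj \<phi> \<psi>) = Conj (translate_fm x \<phi>) (translate_fm x \<psi>)"
| "translate_fm x (Disj \<phi> \<psi>) = Disj (translate_fm x \<phi>) (translate_fm x \<psi>)"
| "translate_fm x (Impl \<phi> \<psi>) = Impl (translate_fm x \<phi>) (translate_fm x \<psi>)"
| "translate_fm x (Equiv \<phi> \<psi>) = Equiv (translate_fm x \<phi>) (translate_fm x \<psi>)"
| "translate_fm x (Ex y \<phi>) = Ex y (translate_fm x \<phi>)"
| "translate_fm x (ExMod t p ys \<phi>) = mod_fm ys t p (translate_fm x \<phi>) x"
| "translate_fm x (ExGe c ys \<phi>) = threshold_fm c ys x (translate_fm x \<phi>)"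
| "translate_fm x (ExEq c ys \<phi>) = Conj (threshold_fm c ys x (translate_fm x \<phi>)) (Neg (threshold_fm (Suc c) ys x (translate_fm x \<phi>)))"

lemma sat_translate_fm: "wf_fm \<phi> \<Longrightarrow> fm_below x \<phi> \<Longrightarrow> sat f (translate_fm x \<phi>) = sat f \<phi>"
proof (induction \<phi> arbitrary: f)
  case (Ex y \<phi>)
  then show ?case by (simp add: sat_Ex)
next
  case (ExMod t p ys \<phi>)
  then have IH: "sat g (translate_fm x \<phi>) = sat g \<phi>" for g by simp
  have "dep x \<phi>" using fm_below_dep ExMod.prems by simp
  then have "dep x (translate_fm x \<phi>)" by (simp add: dep_def IH)
  moreover have "sols f ys (translate_fm x \<phi>) = sols f ys \<phi>" by (simp add: sols_def IH)
  ultimately show ?case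
    unfolding translate_fm.simps sat_ExMod using ExMod.prems by (subst sat_mod_fm) (auto simp: tm_below_tdep)
next
  case (ExGe c ys \<phi>)
  then have IH: "sat g (translate_fm x \<phi>) = sat g \<phi>" for g by simp
  have "dep x \<phi>" using fm_below_dep ExGe.prems by simp
  then have "dep x (translate_fm x \<phi>)" by (simp add: dep_def IH)
  moreover have "sols f ys (translate_fm x \<phi>) = sols f ys \<phi>" by (simp add: sols_def IH)
  moreover have "sat f (ExGe c ys \<phi>) \<longleftrightarrow> atleast c (sols f ys \<phi>)"
    unfolding sols_def atleast_def sat.simps Let_def ..
  ultimately show ?case
    unfolding translate_fm.simps using ExGe.prems by (subst sat_threshold_fm) (auto simp: tuple_ok_def)
next
  case (ExEq c ys \<phi>)
  then have IH: "sat g (translate_fm x \<phi>) = sat g \<phi>" for g by simp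
  have "dep x \<phi>" using fm_below_dep ExEq.prems by simp
  then have "dep x (translate_fm x \<phi>)" by (simp add: dep_def IH)
  then have "sat f (threshold_fm k ys x (translate_fm x \<phi>)) \<longleftrightarrow> atleast k (sols f ys (translate_fm x \<phi>))" for k
    using ExEq.prems by (subst sat_threshold_fm) (auto simp: tuple_ok_def)
  moreover have "sols f ys (translate_fm x \<phi>) = sols f ys \<phi>" by (simp add: sols_def IH)
  moreover have "sat f (ExEq c ys \<phi>) \<longleftrightarrow> finite (sols f ys \<phi>) \<and> card (sols f ys \<phi>) = c"
    unfolding sols_def sat.simps Let_def ..
  ultimately show ?case unfolding translate_fm.simps sat.simps(3,4) atleast_def by auto
qed simp_all

section \<open>Target fragment, coefficients, constants and moduli\<close>

definition restricted :: "(tm \<times> tm) set \<Rightarrow> nat set \<Rightarrow> fm \<Rightarrow> bool" where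
  "restricted A K \<phi> \<longleftrightarrow>
     wf_fm \<phi> \<and> unary_mod_shape \<phi> \<and> less_atoms \<phi> \<subseteq> A \<and> moduli \<phi> \<subseteq> K"

lemma restricted_simps [simp]:
  "restricted A K (Less s t) \<longleftrightarrow> (s, t) \<in> A"
  "restricted A K (CongAt k s t) \<longleftrightarrow> 1 \<le> k \<and> k \<in> K"
  "restricted A K (Neg \<phi>) \<longleftrightarrow> restricted A K \<phi>"
  "restricted A K (Conj \<phi> \<psi>) \<longleftrightarrow> restricted A K \<phi> \<and> restricted A K \<psi>"
  "restricted A K (Disj \<phi> \<psi>) \<longleftrightarrow> restricted A K \<phi> \<and> restricted A K \<psi>"
  "restricted A K (Impl \<phi> \<psi>) \<longleftrightarrow> restricted A K \<phi> \<and> restricted A K \<psi>"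
  "restricted A K (Equiv \<phi> \<psi>) \<longleftrightarrow> restricted A K \<phi> \<and> restricted A K \<psi>"
  "restricted A K (Ex y \<phi>) \<longleftrightarrow> restricted A K \<phi>"
  "restricted A K (ExMod (Num m) p [y] \<phi>) \<longleftrightarrow> 2 \<le> p \<and> p \<in> K \<and> restricted A K \<phi>"
  by (auto simp: restricted_def tuple_ok_def)

lemma restricted_exists_fm [simp]: "restricted A K (exists_fm ys \<phi>) \<longleftrightarrow> restricted A K \<phi>"
  by (induction ys) auto

lemma restricted_true_fm [simp]: "1 \<in> K \<Longrightarrow> restricted A K true_fm"
  by (simp add: true_fm_def)

lemma restricted_lex_less_fm [simp]:
  "1 \<in> K \<Longrightarrow> range (\<lambda>(i, j). (Var i, Var j)) \<subseteq> A \<Longrightarrow> restricted A K (lex_less_fm ys xs)"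
  by (induction ys xs rule: lex_less_fm.induct) (auto simp: image_subset_iff)

lemma restricted_threshold_fm:
  assumes "1 \<in> K" "range (\<lambda>(i, j). (Var i, Var j)) \<subseteq> A"
  shows "restricted A K \<psi> \<Longrightarrow> restricted A K (threshold_fm c ys x \<psi>)"
proof (induction c arbitrary: x \<psi> rule: less_induct)
  case (less c)
  then show ?case using assms
    by (cases "c = 0") (auto simp: threshold_fm.simps[of c] Let_def)
qed

lemma restricted_residue_fm: "2 \<le> p \<Longrightarrow> p \<in> K \<Longrightarrow> restricted A K \<psi> \<Longrightarrow> restricted A K (residue_fm k m t p y \<psi>)"
  by (induction k arbitrary: m) auto

lemma restricted_sum_fm:
  assumes "2 \<le> p" "p \<in> K" "restricted A K E" "\<And>j x. restricted A K (\<mu> j x)"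
  shows "restricted A K (sum_fm k j s x p y E \<mu>)"
  using assms by (induction k arbitrary: j s x) (auto intro!: restricted_residue_fm)

lemma restricted_mod_fm:
  assumes "2 \<le> p" "p \<in> K" "restricted A K \<phi>"
  shows "restricted A K (mod_fm ys t p \<phi> x)"
  using assms by (induction ys arbitrary: t x) (auto intro!: restricted_sum_fm)

text \<open>The pairs of variables in \<open>A\<close> allow for the lexicographic comparisons, and
  1 in \<open>K\<close> for \<open>true_fm\<close>. Every other new modulus is that of the
  quantifier being replaced.\<close>

lemma restricted_translate_fm:
  assumes "1 \<in> K" "range (\<lambda>(i, j). (Var i, Var j)) \<subseteq> A"
  shows "wf_fm \<phi> \<Longrightarrow> less_atoms \<phi> \<subseteq> A \<Longrightarrow> moduli \<phi> \<subseteq> K \<Longrightarrow> restricted A K (translate_fm x \<phi>)"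
  by (induction \<phi>) (auto simp: restricted_threshold_fm[OF assms] restricted_mod_fm)

text \<open>For \<open>i = j\<close> the occurrences cancel and no coefficient remains. Comparisons
  of variables thus contribute only members of every \<open>Coeff\<close>.\<close>

lemma Coeff_Var_less: "coeffs_nf (Sub (Var i) (Var j)) \<subseteq> {1, - 1}"
  by (auto simp: coeffs_nf_def Sub_def split: if_splits)

lemma parameters_translate_fm:
  assumes "wf_fm \<phi>"
  shows "translate_fm x \<phi> \<in> FO_unary_mod" "Coeff (translate_fm x \<phi>) \<subseteq> Coeff \<phi>"
    "Constants (translate_fm x \<phi>) \<subseteq> Constants \<phi>" "Mod (translate_fm x \<phi>) \<subseteq> Mod \<phi>"
proof -
  let ?V = "range (\<lambda>(i, j). (Var i, Var j))"
  have r: "restricted (?V \<union> less_atoms \<phi>) (Mod \<phi>) (translate_fm x \<phi>)"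
    by (rule restricted_translate_fm) (auto simp: assms Mod_def)
  then show "translate_fm x \<phi> \<in> FO_unary_mod" "Mod (translate_fm x \<phi>) \<subseteq> Mod \<phi>"
    by (auto simp: restricted_def FO_unary_mod_def Mod_def)
  have la: "less_atoms (translate_fm x \<phi>) \<subseteq> ?V \<union> less_atoms \<phi>" using r by (simp add: restricted_def)
  show "Coeff (translate_fm x \<phi>) \<subseteq> Coeff \<phi>"
  proof
    fix a assume "a \<in> Coeff (translate_fm x \<phi>)"
    then consider "a \<in> {0, 1, - 1, 2, - 2}"
      | s t b where "(s, t) \<in> less_atoms (translate_fm x \<phi>)" "b \<in> coeffs_nf (Sub s t)" "a = b \<or> a = - b"
      unfolding Coeff_def by blast
    then show "a \<in> Coeff \<phi>"
    proof cases
      case 2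
      show ?thesis
      proof (cases "(s, t) \<in> less_atoms \<phi>")
        case True
        then show ?thesis unfolding Coeff_def using 2(2,3) by blast
      next
        case False
        then obtain i j where "s = Var i" "t = Var j" using la 2(1) by auto
        then have "b \<in> {1, - 1}" using 2(2) Coeff_Var_less by blast
        then show ?thesis using 2(3) by (auto simp: Coeff_def)
      qed
    qed (auto simp: Coeff_def)
  qed
  show "Constants (translate_fm x \<phi>) \<subseteq> Constants \<phi>"
  proof
    fix a assume "a \<in> Constants (translate_fm x \<phi>)"
    then consider "a \<in> {0, 1, - 1, 2, - 2}"
      | s t where "(s, t) \<in> less_atoms (translate_fm x \<phi>)" "a = tconst (Sub s t) \<or> a = - tconst (Sub s t)"
      unfolding Constants_def by blast
    then show "a \<in> Constants \<phi>"
    proof cases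
      case 2
      show ?thesis
      proof (cases "(s, t) \<in> less_atoms \<phi>")
        case True
        then show ?thesis unfolding Constants_def using 2(2) by blast
      next
        case False
        then obtain i j where "s = Var i" "t = Var j" using la 2(1) by auto
        then show ?thesis using 2(2) by (auto simp: Constants_def Sub_def)
      qed
    qed (auto simp: Constants_def)
  qed
qed

section \<open>Quantifier depth\<close>

lemma qd_exists_fm [simp]: "qd (exists_fm ys \<phi>) = length ys + qd \<phi>"
  by (induction ys) auto

lemma qd_lex_less_fm [simp]: "qd (lex_less_fm ys xs) = 0"
  by (induction ys xs rule: lex_less_fm.induct) (auto simp: true_fm_def)

text \<open>Each digit of \<open>c\<close> costs the quantifiers of one pivot. The block that
  quantifies \<open>ys\<close> again stands beside the recursive calls, so it is paid only once, by
  the summand 1.\<close>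

lemma qd_threshold_fm: "qd (threshold_fm c ys x \<psi>) \<le> qd \<psi> + length ys * (length (bits c) + 1)"
proof (induction c arbitrary: x \<psi> rule: less_induct)
  case (less c)
  show ?case
  proof (cases "c = 0")
    case False
    have "qd (threshold_fm (c div 2) ys x' (Conj \<chi> \<psi>)) \<le> qd \<psi> + length ys * (length (bits (c div 2)) + 1)"
      if "qd \<chi> = 0" for x' \<chi>
      using less[of "c div 2" x' "Conj \<chi> \<psi>"] False that by simp
    moreover have "length (bits c) = Suc (length (bits (c div 2)))" using False by (simp add: bits_pos)
    ultimately show ?thesis using False
      by (auto simp: threshold_fm.simps[of c] Let_def fresh_vars(1))
  qed (simp add: true_fm_def)
qed

lemma qd_residue_fm: "qd (residue_fm k m t p y \<psi>) = 1 + qd \<psi>"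
  by (induction k arbitrary: m) auto

text \<open>The halves stand side by side, so each level of the tree costs one quantifier; the 2 is
  the guess at a leaf and the counting quantifier below it.\<close>

lemma qd_sum_fm:
  assumes "qd E \<le> d" "\<And>j x. qd (\<mu> j x) \<le> d"
  shows "qd (sum_fm k j s x p y E \<mu>) \<le> k + 2 + d"
  using assms by (induction k arbitrary: j s x) (auto simp: qd_residue_fm)

lemma qd_mod_fm: "qd (mod_fm ys t p \<phi> x) \<le> qd \<phi> + length ys * (length (bits p) + 3)"
proof (induction ys arbitrary: t x)
  case (Cons y ys)
  let ?L = "length (bits p)"
  have "qd (sum_fm ?L 0 t x p y (exists_fm ys \<phi>) (\<lambda>j. mod_fm ys (Num j) p \<phi>)) \<le>
      ?L + 2 + (qd \<phi> + length ys * (?L + 3))"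
    by (rule qd_sum_fm) (use Cons in auto)
  with Cons[of "Var x" "next_var x"] show ?case by simp
qed simp

lemma length_bits_Suc: "length (bits (Suc n)) \<le> Suc (length (bits n))"
proof (induction n rule: less_induct)
  case (less n)
  show ?case
  proof (cases "odd n")
    case True
    then have "Suc n div 2 = Suc (n div 2)" "0 < n" by (auto elim: oddE)
    then show ?thesis using less[of "n div 2"] by (simp add: bits_pos)
  next
    case False
    then have "Suc n div 2 = n div 2" by auto
    then show ?thesis by (cases "n = 0") (simp_all add: bits_pos)
  qed
qed

lemma length_le_sum_nat_size: "length ys \<le> sum_list (map nat_size ys)"
  by (induction ys) (auto simp: nat_size_def)

text \<open>\<open>N\<close> is the size of the whole formula and bounds all digit lengths while the
  induction descends. A counting quantifier costs at most \<open>length ys * (N + 3)\<close>, and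
  \<open>length ys\<close> is paid by the share of \<open>ys\<close> in
  \<open>fm_size\<close>.\<close>

lemma qd_translate_fm: "fm_size \<phi> \<le> N \<Longrightarrow> qd (translate_fm x \<phi>) \<le> fm_size \<phi> * (N + 3)"
proof (induction \<phi>)
  case (ExMod t p ys \<phi>)
  have "length ys * (length (bits p) + 3) \<le> sum_list (map nat_size ys) * (N + 3)"
    using ExMod.prems length_le_sum_nat_size[of ys] by (intro mult_le_mono) (auto simp: nat_size_def)
  with qd_mod_fm[of ys t p "translate_fm x \<phi>" x] ExMod show ?case by (auto simp: add_mult_distrib)
next
  case (ExGe c ys \<phi>)
  have "length ys * (length (bits c) + 1) \<le> sum_list (map nat_size ys) * (N + 3)"
    using ExGe.prems length_le_sum_nat_size[of ys] by (intro mult_le_mono) (auto simp: nat_size_def)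
  with qd_threshold_fm[of c ys x "translate_fm x \<phi>"] ExGe show ?case by (auto simp: add_mult_distrib)
next
  case (ExEq c ys \<phi>)
  have "length ys * (length (bits c) + 1) \<le> sum_list (map nat_size ys) * (N + 3)"
    using ExEq.prems length_le_sum_nat_size[of ys] by (intro mult_le_mono) (auto simp: nat_size_def)
  moreover
  have "length ys * (length (bits (Suc c)) + 1) \<le> sum_list (map nat_size ys) * (N + 3)"
    using ExEq.prems length_le_sum_nat_size[of ys] length_bits_Suc[of c]
    by (intro mult_le_mono) (auto simp: nat_size_def)
  ultimately show ?case
    using qd_threshold_fm[of c ys x "translate_fm x \<phi>"] qd_threshold_fm[of "Suc c" ys x "translate_fm x \<phi>"] ExEq
    by (auto simp: add_mult_distrib)
qed (auto simp: add_mult_distrib)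

section \<open>The program\<close>

primrec constE :: "tree \<Rightarrow> expr" where
  "constE Leaf = LeafE"
| "constE (Pair a b) = PairE (constE a) (constE b)"

primrec listE :: "expr list \<Rightarrow> expr" where
  "listE [] = LeafE"
| "listE (e # es) = PairE e (listE es)"

definition nodeE :: "nat \<Rightarrow> expr list \<Rightarrow> expr" where
  "nodeE k es = PairE (constE (enc_nat k)) (listE es)"

text \<open>The test keeps 0 the empty word when it is doubled, as numbers have no leading
  zeros.\<close>

definition zeroE :: "expr \<Rightarrow> expr" where
  "zeroE e = IfPair e (PairE LeafE e) LeafE"

definition oneE :: "expr \<Rightarrow> expr" where
  "oneE e = PairE (PairE LeafE LeafE) e"

text \<open>The pattern is known when the program is written, so matching unfolds to nested tests
  without calls. Copying the failure branch only affects the constant weight of the body.\<close>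

primrec matchE :: "expr \<Rightarrow> tree \<Rightarrow> expr \<Rightarrow> expr \<Rightarrow> expr" where
  "matchE e Leaf a b = IfPair e b a"
| "matchE e (Pair l r) a b = IfPair e (matchE (Fst e) l (matchE (Snd e) r a b) b) b"

lemma run_constE [simp]: "runE c (constE t) env = Some t"
  by (induction t) auto

lemma run_listE: "runE c (listE es) env = map_option enc_list (runEs c es env)"
  by (induction es) (auto split: bind_split)

lemma run_nodeE [simp]: "runE c (nodeE k es) env = map_option (node k) (runEs c es env)"
  by (cases "runEs c es env") (simp_all add: nodeE_def run_listE node_def)

lemma run_matchE:
  "runE c e env = Some v \<Longrightarrow>
    runE c (matchE e k a b) env = (if v = k then runE c a env else runE c b env)"
proof (induction k arbitrary: e v a b)
  case (Pair l r)
  then show ?case by (cases v) auto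
qed simp

lemma enc_nat_0 [simp]: "enc_nat 0 = Leaf"
  by (simp add: enc_nat_def)

lemma enc_nat_pos: "0 < n \<Longrightarrow> enc_nat n = Pair (enc_bool (odd n)) (enc_nat (n div 2))"
  by (simp add: enc_nat_def bits_pos)

lemma enc_nat_eq_Leaf [simp]: "enc_nat n = Leaf \<longleftrightarrow> n = 0"
  using enc_nat_inj[of n 0] by simp

lemma enc_bool_eq_Leaf [simp]: "enc_bool b = Leaf \<longleftrightarrow> \<not> b"
  by (simp add: enc_bool_def)

lemma enc_list_eq_Leaf [simp]: "enc_list ts = Leaf \<longleftrightarrow> ts = []"
  by (cases ts) auto

lemma run_zeroE [simp]:
  "runE c e env = Some (enc_nat m) \<Longrightarrow> runE c (zeroE e) env = Some (enc_nat (2 * m))"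
  by (cases "m = 0") (simp_all add: zeroE_def enc_nat_pos[of "2 * m"] enc_bool_def)

lemma run_oneE [simp]:
  "runE c e env = Some (enc_nat m) \<Longrightarrow> runE c (oneE e) env = Some (enc_nat (Suc (2 * m)))"
  by (simp add: oneE_def enc_nat_pos[of "Suc (2 * m)"] enc_bool_def)

lemma node_proj [simp]: "tfst (node k ts) = enc_nat k" "tsnd (node k ts) = enc_list ts"
  by (simp_all add: node_def)

lemma enc_int_int [simp]: "enc_int (int m) = Pair Leaf (enc_nat m)"
  by (simp add: enc_int_def enc_bool_def)

section \<open>Function bodies\<close>

abbreviation natE :: "expr \<Rightarrow> expr" where
  "natE e \<equiv> nodeE 1 [PairE LeafE e]"

abbreviation childE :: "nat \<Rightarrow> nat \<Rightarrow> expr" where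
  "childE i a \<equiv> Fst ((Snd ^^ Suc i) (Arg a))"

text \<open>Every leaf of the input prefixes the accumulator with a digit 1. Started at 0, this
  yields a number with as many ones as the input has leaves, hence a first fresh variable above all
  variables of the input, found without parsing it or comparing numbers.\<close>

definition flattenB :: expr where
  "flattenB = IfPair (Arg 0) (Call 1 [Fst (Arg 0), Call 1 [Snd (Arg 0), Arg 1]]) (oneE (Arg 1))"

text \<open>The last branch is the one for tag 10. There the translated body is bound first, which
  shifts the node to \<open>Arg 1\<close> and the fresh variable to \<open>Arg 2\<close>.\<close>

definition translateB :: expr where
  "translateB =
    (let tag = matchE (Fst (Arg 0)) \<circ> enc_nat; tr = \<lambda>i. Call 2 [childE i 0, Arg 1] in
     tag 0 (Arg 0) (tag 1 (Arg 0)
    (tag 2 (nodeE 2 [tr 0])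
    (tag 3 (nodeE 3 [tr 0, tr 1])
    (tag 4 (nodeE 4 [tr 0, tr 1])
    (tag 5 (nodeE 5 [tr 0, tr 1])
    (tag 6 (nodeE 6 [tr 0, tr 1])
    (tag 7 (nodeE 7 [childE 0 0, tr 1])
    (tag 8 (Call 11 [childE 2 0, childE 0 0, childE 1 0, tr 3, Arg 1])
    (tag 9 (Call 7 [childE 0 0, childE 1 0, Arg 1, tr 2])
    (LetE (tr 2) (nodeE 3
       [Call 7 [childE 0 1, childE 1 1, Arg 2, Arg 0],
        nodeE 2 [Call 7 [Call 8 [childE 0 1], childE 1 1, Arg 2, Arg 0]]]))))))))))))"

definition exsB :: expr where
  "exsB = IfPair (Arg 0) (nodeE 7 [Fst (Arg 0), Call 3 [Snd (Arg 0), Arg 1]]) (Arg 1)"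

definition lessB :: expr where
  "lessB = IfPair (Arg 0)
    (nodeE 4
      [nodeE 0 [nodeE 0 [Fst (Arg 0)], nodeE 0 [Fst (Arg 1)]],
       nodeE 3
         [nodeE 2 [nodeE 0 [nodeE 0 [Fst (Arg 1)], nodeE 0 [Fst (Arg 0)]]],
          Call 4 [Snd (Arg 0), Snd (Arg 1)]]])
    (constE (enc_fm (Neg true_fm)))"

definition freshB :: expr where
  "freshB = IfPair (Arg 0) (PairE (Arg 1) (Call 5 [Snd (Arg 0), oneE (Arg 1)])) LeafE"

definition afterB :: expr where
  "afterB = IfPair (Arg 0) (Call 6 [Snd (Arg 0), oneE (Arg 1)]) (Arg 1)"

text \<open>Below the four lets, \<open>Arg 0\<close> to \<open>Arg 7\<close> are: the formula for
  above the pivot, the one for below it, the next fresh variable, the pivot tuple, \<open>c\<close>,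
  \<open>ys\<close>, \<open>x\<close> and \<open>\<psi>\<close>. Digits start with the least
  significant one, so \<open>Snd\<close> halves \<open>c\<close> and \<open>Fst\<close> gives its
  parity.\<close>

definition geB :: expr where
  "geB = IfPair (Arg 0)
    (LetE (Call 5 [Arg 1, Arg 2]) (LetE (Call 6 [Arg 2, Arg 3]) (LetE (Call 4 [Arg 3, Arg 1])
    (LetE (Call 4 [Arg 2, Arg 4])
      (Call 3 [Arg 3, nodeE 3
        [Call 3 [Arg 5, nodeE 3 [nodeE 2 [Arg 1], nodeE 3 [nodeE 2 [Arg 0], Arg 7]]],
         nodeE 3
           [Call 7 [Snd (Arg 4), Arg 5, Arg 2, nodeE 3 [Arg 1, Arg 7]],
            Call 7 [Snd (Arg 4), Arg 5, Arg 2,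
              nodeE 3 [IfPair (Fst (Arg 4)) (Arg 0) (nodeE 2 [Arg 1]), Arg 7]]]]])))))
    (constE (enc_fm true_fm))"

definition incB :: expr where
  "incB = IfPair (Arg 0)
    (IfPair (Fst (Arg 0)) (PairE LeafE (Call 8 [Snd (Arg 0)])) (oneE (Snd (Arg 0))))
    (oneE LeafE)"

text \<open>\<open>Arg 0\<close> is a unary counter of which only the length matters; the digit list
  of \<open>p\<close> is passed for it.\<close>

definition orB :: expr where
  "orB = IfPair (Arg 0)
    (nodeE 4
      [Call 9 [Snd (Arg 0), zeroE (Arg 1), Arg 2, Arg 3, Arg 4, Arg 5],
       Call 9 [Snd (Arg 0), oneE (Arg 1), Arg 2, Arg 3, Arg 4, Arg 5]])
    (nodeE 3
      [nodeE 1 [Arg 3, Arg 2, natE (Arg 1)],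
       nodeE 8 [natE (Arg 1), Arg 3, PairE (Arg 4) LeafE, Arg 5]])"

text \<open>As digits are read from the least significant one, \<open>Arg 2\<close> carries the
  verdict so far: equal digits keep it, and a later difference overrules it.\<close>

definition ltB :: expr where
  "ltB = IfPair (Arg 0)
    (IfPair (Arg 1)
      (Call 10 [Snd (Arg 0), Snd (Arg 1),
        IfPair (Fst (Arg 0)) (IfPair (Fst (Arg 1)) (Arg 2) LeafE)
          (IfPair (Fst (Arg 1)) (PairE LeafE LeafE) (Arg 2))])
      LeafE)
    (IfPair (Arg 1) (PairE LeafE LeafE) (Arg 2))"

definition modB :: expr where
  "modB = IfPair (Arg 0)
    (nodeE 3
      [nodeE 2 [nodeE 7 [Fst (Arg 0), nodeE 2 [nodeE 7 [Arg 4,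
         Call 11 [Snd (Arg 0), nodeE 0 [Arg 4], Arg 2, Arg 3, oneE (Arg 4)]]]]],
       Call 12 [Arg 2, LeafE, Arg 1, Arg 4, Arg 0, Arg 2, Arg 3]])
    (nodeE 4
      [nodeE 3 [Arg 3, nodeE 1 [Arg 2, Arg 1, constE (enc_tm (Num 1))]],
       nodeE 3 [nodeE 2 [Arg 3], nodeE 1 [Arg 2, Arg 1, constE (enc_tm (Num 0))]]])"

text \<open>\<open>Arg 0\<close> is again a unary counter. \<open>Arg 4\<close> is the whole tuple:
  its head is counted at the leaves, and its tail goes back to function 11.\<close>

definition sumB :: expr where
  "sumB = IfPair (Arg 0)
    (nodeE 7 [Arg 3, nodeE 3
      [Call 12 [Snd (Arg 0), zeroE (Arg 1), nodeE 0 [Arg 3], oneE (Arg 3), Arg 4, Arg 5, Arg 6],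
       Call 12 [Snd (Arg 0), oneE (Arg 1),
         nodeE 2 [Arg 2, nodeE 3 [constE (enc_int (- 1)), nodeE 0 [Arg 3]]],
         oneE (Arg 3), Arg 4, Arg 5, Arg 6]]])
    (IfPair (Call 10 [Arg 1, Arg 5, LeafE])
      (nodeE 7 [Arg 3, nodeE 3
        [Call 9 [Arg 5, LeafE, nodeE 0 [Arg 3], Arg 5, Fst (Arg 4),
           nodeE 3 [Call 3 [Snd (Arg 4), Arg 6],
             Call 11 [Snd (Arg 4), natE (Arg 1), Arg 5, Arg 6, oneE (Arg 3)]]],
         nodeE 1 [Arg 5, Arg 2, nodeE 3 [PairE LeafE (Arg 1), nodeE 0 [Arg 3]]]]])
      (nodeE 1 [Arg 5, Arg 2, constE (enc_tm (Num 0))]))"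

definition prog :: program where
  "prog = [Call 2 [Arg 0, Call 1 [Arg 0, LeafE]], flattenB, translateB, exsB, lessB, freshB, afterB,
    geB, incB, orB, ltB, modB, sumB]"

lemma call_prog:
  "call prog (Suc h) 0 = runE (call prog h) (Call 2 [Arg 0, Call 1 [Arg 0, LeafE]])"
  "call prog (Suc h) (Suc 0) = runE (call prog h) flattenB"
  "call prog (Suc h) 2 = runE (call prog h) translateB"
  "call prog (Suc h) 3 = runE (call prog h) exsB"
  "call prog (Suc h) 4 = runE (call prog h) lessB"
  "call prog (Suc h) 5 = runE (call prog h) freshB"
  "call prog (Suc h) 6 = runE (call prog h) afterB"
  "call prog (Suc h) 7 = runE (call prog h) geB"
  "call prog (Suc h) 8 = runE (call prog h) incB"
  "call prog (Suc h) 9 = runE (call prog h) orB"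
  "call prog (Suc h) 10 = runE (call prog h) ltB"
  "call prog (Suc h) 11 = runE (call prog h) modB"
  "call prog (Suc h) 12 = runE (call prog h) sumB"
  by (simp_all add: prog_def fun_eq_iff)

declare call.simps [simp del]

section \<open>Results of the functions and the call depths they take\<close>

primrec flatten :: "tree \<Rightarrow> nat \<Rightarrow> nat" where
  "flatten Leaf m = next_var m"
| "flatten (Pair a b) m = flatten a (flatten b m)"

lemma call_flatten:
  "tree_size t \<le> h \<Longrightarrow> call prog h (Suc 0) [t, enc_nat m] = Some (enc_nat (flatten t m))"
proof (induction t arbitrary: h m)
  case Leaf
  then obtain h' where "h = Suc h'" by (cases h) auto
  then show ?case by (simp add: call_prog flattenB_def)
next
  case (Pair a b)
  then obtain h' where "h = Suc h'" by (cases h) auto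
  with Pair show ?case by (simp add: call_prog flattenB_def)
qed

lemma call_exists_fm:
  "length ys < h \<Longrightarrow>
    call prog h 3 [enc_list (map enc_nat ys), enc_fm \<phi>] = Some (enc_fm (exists_fm ys \<phi>))"
proof (induction ys arbitrary: h)
  case Nil
  then obtain h' where "h = Suc h'" by (cases h) auto
  then show ?case by (simp add: call_prog exsB_def)
next
  case (Cons y ys)
  then obtain h' where "h = Suc h'" by (cases h) auto
  with Cons show ?case by (simp add: call_prog exsB_def)
qed

lemma call_less:
  "length ys < h \<Longrightarrow> length xs = length ys \<Longrightarrow>
    call prog h 4 [enc_list (map enc_nat ys), enc_list (map enc_nat xs)] = Some (enc_fm (lex_less_fm ys xs))"
proof (induction ys arbitrary: h xs)
  case Nil
  then obtain h' where "h = Suc h'" by (cases h) auto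
  then show ?case using Nil by (simp add: call_prog lessB_def)
next
  case (Cons y ys)
  then obtain h' x xs' where "h = Suc h'" "xs = x # xs'" by (cases h; cases xs) auto
  with Cons show ?case by (simp add: call_prog lessB_def)
qed

lemma call_fresh:
  "length ys < h \<Longrightarrow> call prog h 5 [enc_list (map enc_nat ys), enc_nat x] =
    Some (enc_list (map enc_nat (fresh_vars ys x)))"
proof (induction ys arbitrary: h x)
  case Nil
  then obtain h' where "h = Suc h'" by (cases h) auto
  then show ?case by (simp add: call_prog freshB_def)
next
  case (Cons y ys)
  then obtain h' where "h = Suc h'" by (cases h) auto
  with Cons show ?case by (simp add: call_prog freshB_def)
qed

lemma call_after:
  "length ys < h \<Longrightarrow> call prog h 6 [enc_list (map enc_nat ys), enc_nat x] =
    Some (enc_nat (var_after ys x))"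
proof (induction ys arbitrary: h x)
  case Nil
  then obtain h' where "h = Suc h'" by (cases h) auto
  then show ?case by (simp add: call_prog afterB_def)
next
  case (Cons y ys)
  then obtain h' where "h = Suc h'" by (cases h) auto
  with Cons show ?case by (simp add: call_prog afterB_def)
qed

lemma call_inc: "length (bits n) < h \<Longrightarrow> call prog h 8 [enc_nat n] = Some (enc_nat (Suc n))"
proof (induction n arbitrary: h rule: less_induct)
  case (less n)
  then obtain h' where h: "h = Suc h'" by (cases h) auto
  consider "n = 0" | "odd n" | "0 < n" "even n" by fastforce
  then show ?case
  proof cases
    case 1
    then show ?thesis using h run_oneE[of _ LeafE _ 0] by (simp add: call_prog incB_def)
  next
    case 2
    then have n: "0 < n" by (auto elim: oddE)
    have "call prog h' 8 [enc_nat (n div 2)] = Some (enc_nat (Suc (n div 2)))"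
      using less h n by (simp add: bits_pos)
    moreover have "Suc n div 2 = Suc (n div 2)" using 2 by presburger
    ultimately show ?thesis using h n 2
      by (simp add: call_prog incB_def enc_nat_pos[of n] enc_nat_pos[of "Suc n"]) (simp add: enc_bool_def)
  next
    case 3
    then have "Suc (2 * (n div 2)) = Suc n" by simp
    then show ?thesis using h 3 run_oneE[of _ "Snd (Arg 0)" "[enc_nat n]" "n div 2"]
      by (simp add: call_prog incB_def enc_nat_pos[of n])
  qed
qed

lemma call_lt:
  "length (bits n) < h \<Longrightarrow>
    call prog h 10 [enc_nat m, enc_nat n, enc_bool b] = Some (enc_bool (m < n \<or> m = n \<and> b))"
proof (induction n arbitrary: h m b rule: less_induct)
  case (less n)
  then obtain h' where h: "h = Suc h'" by (cases h) auto
  show ?case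
  proof (cases "m = 0 \<or> n = 0")
    case True
    then show ?thesis using h by (auto simp: call_prog ltB_def enc_bool_def)
  next
    case False
    have IH: "call prog h' 10 [enc_nat (m div 2), enc_nat (n div 2), enc_bool b'] =
        Some (enc_bool (m div 2 < n div 2 \<or> m div 2 = n div 2 \<and> b'))" for b'
      using less h False by (simp add: bits_pos)
    have c: "m < n \<or> m = n \<and> b \<longleftrightarrow> m div 2 < n div 2 \<or>
        m div 2 = n div 2 \<and> (if odd m then odd n \<and> b else odd n \<or> b)"
      by (cases b; cases "odd m"; cases "odd n"; simp; presburger)
    show ?thesis
      using h False IH[of "odd n \<and> b"] IH[of "odd n \<or> b"] unfolding c
      by (cases b; cases "odd m"; cases "odd n")
        (simp_all add: call_prog ltB_def enc_nat_pos[of m] enc_nat_pos[of n] enc_bool_def)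
  qed
qed

lemma call_or:
  "length ts < h \<Longrightarrow>
    call prog h 9 [enc_list ts, enc_nat m, enc_tm t, enc_nat p, enc_nat y, enc_fm \<psi>] =
      Some (enc_fm (residue_fm (length ts) m t p y \<psi>))"
proof (induction ts arbitrary: h m)
  case Nil
  then obtain h' where "h = Suc h'" by (cases h) auto
  then show ?case by (simp add: call_prog orB_def)
next
  case (Cons u ts)
  then obtain h' where "h = Suc h'" by (cases h) auto
  with Cons show ?case by (simp add: call_prog orB_def)
qed

lemmas call_or_bits = call_or[of "map enc_bool (bits _)", folded enc_nat_def, unfolded length_map]

lemma call_ge:
  "length ys + length (bits c) + 1 < h \<Longrightarrow>
    call prog h 7 [enc_nat c, enc_list (map enc_nat ys), enc_nat x, enc_fm \<psi>] =
      Some (enc_fm (threshold_fm c ys x \<psi>))"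
proof (induction c arbitrary: h x \<psi> rule: less_induct)
  case (less c)
  then obtain h' where h: "h = Suc h'" by (cases h) auto
  show ?case
  proof (cases "c = 0")
    case True
    then show ?thesis using h by (simp add: call_prog geB_def)
  next
    case False
    have IH: "call prog h' 7 [enc_nat (c div 2), enc_list (map enc_nat ys), enc_nat x', enc_fm \<chi>] =
        Some (enc_fm (threshold_fm (c div 2) ys x' \<chi>))" for x' \<chi>
      using less h False by (simp add: bits_pos)
    have len: "length ys < h'" using less.prems h by simp
    note IH' = IH[of _ "Conj _ _", unfolded enc_fm.simps] IH[of _ "Conj (Neg _) _", unfolded enc_fm.simps]
    let ?xs = "fresh_vars ys x" and ?x' = "var_after ys x"
    let ?eq = "Conj (Neg (lex_less_fm ys ?xs)) (Conj (Neg (lex_less_fm ?xs ys)) \<psi>)"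
    let ?high = "if odd c then lex_less_fm ?xs ys else Neg (lex_less_fm ys ?xs)"
    let ?B = "Conj (exists_fm ys ?eq) (Conj (threshold_fm (c div 2) ys ?x' (Conj (lex_less_fm ys ?xs) \<psi>))
      (threshold_fm (c div 2) ys ?x' (Conj ?high \<psi>)))"
    have threshold_fm: "threshold_fm c ys x \<psi> = exists_fm ?xs ?B" using False by (simp add: threshold_fm.simps[of c] Let_def)
    show ?thesis
      unfolding threshold_fm using False len call_exists_fm[of ys h' ?eq] call_exists_fm[of ?xs h' ?B]
      by (cases "odd c")
        (simp_all add: h call_prog geB_def enc_nat_pos[of c] fresh_vars(1)
          call_fresh call_after call_less IH')
  qed
qed

text \<open>Functions 11 and 12 call each other. Instead of a mutual induction, the assumption
  states the correctness of function 11 on the tail, which is the induction hypothesis of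
  \<open>call_mod\<close>. One level is added for each entry of \<open>ts\<close> and one for the
  leaf.\<close>

lemma call_sum:
  assumes rec: "\<And>h t x. length ys * (length (bits p) + 4) + length (bits p) + length ys < h \<Longrightarrow>
      call prog h 11 [enc_list (map enc_nat ys), enc_tm t, enc_nat p, enc_fm \<phi>, enc_nat x] =
        Some (enc_fm (mod_fm ys t p \<phi> x))"
  shows "length ts + 1 + length ys * (length (bits p) + 4) + length (bits p) + length ys < h \<Longrightarrow>
    call prog h 12 [enc_list ts, enc_nat j, enc_tm s, enc_nat x, enc_list (map enc_nat (y # ys)),
      enc_nat p, enc_fm \<phi>] =
    Some (enc_fm (sum_fm (length ts) j s x p y (exists_fm ys \<phi>) (\<lambda>j. mod_fm ys (Num j) p \<phi>)))"
proof (induction ts arbitrary: h j s x)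
  case Nil
  then obtain h' where h: "h = Suc h'" by (cases h) auto
  have lt: "call prog h' 10 [enc_nat j, enc_nat p, Leaf] = Some (enc_bool (j < p))"
    using call_lt[of p h' j False] Nil h by (simp add: enc_bool_def)
  have rec': "call prog h' 11 [enc_list (map enc_nat ys), enc_tm (Num j), enc_nat p, enc_fm \<phi>, enc_nat x'] =
      Some (enc_fm (mod_fm ys (Num j) p \<phi> x'))" for x'
    using Nil h by (intro rec) simp
  have residue_fm: "call prog h' 9 [enc_nat p, enc_nat 0, enc_tm (Var x), enc_nat p, enc_nat y,
      enc_fm (Conj (exists_fm ys \<phi>) (mod_fm ys (Num j) p \<phi> (next_var x)))] =
      Some (enc_fm (residue_fm (length (bits p)) 0 (Var x) p y
        (Conj (exists_fm ys \<phi>) (mod_fm ys (Num j) p \<phi> (next_var x)))))"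
    using Nil h by (intro call_or_bits) simp
  have exists_fm: "call prog h' 3 [enc_list (map enc_nat ys), enc_fm \<phi>] = Some (enc_fm (exists_fm ys \<phi>))"
    using Nil h by (intro call_exists_fm) simp
  show ?case using lt rec' residue_fm exists_fm by (simp add: h call_prog sumB_def)
next
  case (Cons u ts)
  then obtain h' where h: "h = Suc h'" by (cases h) auto
  note IH = Cons.IH[of h'] Cons.IH[of h' _ "Var x"] Cons.IH[of h' _ "Add s (Mul (- 1) (Var x))"]
  show ?case using IH Cons.prems by (simp add: h call_prog sumB_def)
qed

text \<open>Each variable adds the \<open>length (bits p)\<close> levels of its sum tree and a
  constant. The other summands leave room for comparing numbers, for \<open>residue_fm\<close> and
  for \<open>exists_fm\<close>.\<close>

lemma call_mod:
  "length ys * (length (bits p) + 4) + length (bits p) + length ys < h \<Longrightarrow>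
    call prog h 11 [enc_list (map enc_nat ys), enc_tm t, enc_nat p, enc_fm \<phi>, enc_nat x] =
      Some (enc_fm (mod_fm ys t p \<phi> x))"
proof (induction ys arbitrary: h t x)
  case Nil
  then obtain h' where h: "h = Suc h'" by (cases h) auto
  show ?case by (simp add: h call_prog modB_def)
next
  case (Cons y ys)
  then obtain h' where h: "h = Suc h'" by (cases h) auto
  have rec: "call prog h' 11 [enc_list (map enc_nat ys), enc_tm (Var x), enc_nat p, enc_fm \<phi>,
      enc_nat (next_var x)] = Some (enc_fm (mod_fm ys (Var x) p \<phi> (next_var x)))"
    using Cons.prems h by (intro Cons.IH) simp
  have "call prog h' 12 [enc_list (map enc_bool (bits p)), enc_nat 0, enc_tm t, enc_nat x,
      enc_list (map enc_nat (y # ys)), enc_nat p, enc_fm \<phi>] =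
      Some (enc_fm (sum_fm (length (map enc_bool (bits p))) 0 t x p y (exists_fm ys \<phi>)
        (\<lambda>j. mod_fm ys (Num j) p \<phi>)))"
    by (rule call_sum[OF Cons.IH]) (use Cons.prems h in auto)
  then have "call prog h' 12 [enc_nat p, enc_nat 0, enc_tm t, enc_nat x,
      enc_list (map enc_nat (y # ys)), enc_nat p, enc_fm \<phi>] =
      Some (enc_fm (sum_fm (length (bits p)) 0 t x p y (exists_fm ys \<phi>) (\<lambda>j. mod_fm ys (Num j) p \<phi>)))"
    unfolding length_map enc_nat_def[of p, symmetric] .
  then show ?case using rec by (simp add: h call_prog modB_def)
qed

lemma funpow_numerals:
  "(f ^^ 2) a = f (f a)" "(f ^^ 3) a = f (f (f a))" "(f ^^ 4) a = f (f (f (f a)))"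
  by (simp_all add: eval_nat_numeral)

text \<open>\<open>fm_size\<close> pays one level per constructor. \<open>N * (N + 6)\<close> is
  \<open>N * (N + 4) + N + N\<close>, the depth from \<open>call_mod\<close> with tuple and digit
  lengths at most \<open>N\<close>; together with the 2 it also covers the threshold formulas,
  including the one for \<open>Suc c\<close>.\<close>

lemma call_translate:
  "fm_size \<phi> \<le> N \<Longrightarrow> fm_size \<phi> + N * (N + 6) + 2 < h \<Longrightarrow>
    call prog h 2 [enc_fm \<phi>, enc_nat x] = Some (enc_fm (translate_fm x \<phi>))"
proof (induction \<phi> arbitrary: h)
  case (Less s t)
  then obtain h' where h: "h = Suc h'" by (cases h) auto
  show ?case by (simp add: h call_prog translateB_def run_matchE enc_nat_inj Let_def)
next
  case (CongAt k s t)
  then obtain h' where h: "h = Suc h'" by (cases h) auto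
  show ?case by (simp add: h call_prog translateB_def run_matchE enc_nat_inj Let_def)
next
  case (Neg \<phi>)
  then obtain h' where h: "h = Suc h'" by (cases h) auto
  show ?case using Neg.IH[of h'] Neg.prems
    by (simp add: h call_prog translateB_def run_matchE enc_nat_inj Let_def)
next
  case (Conj \<phi> \<psi>)
  then obtain h' where h: "h = Suc h'" by (cases h) auto
  show ?case using Conj.IH[of h'] Conj.prems
    by (simp add: h call_prog translateB_def run_matchE enc_nat_inj Let_def)
next
  case (Disj \<phi> \<psi>)
  then obtain h' where h: "h = Suc h'" by (cases h) auto
  show ?case using Disj.IH[of h'] Disj.prems
    by (simp add: h call_prog translateB_def run_matchE enc_nat_inj Let_def)
next
  case (Impl \<phi> \<psi>)
  then obtain h' where h: "h = Suc h'" by (cases h) auto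
  show ?case using Impl.IH[of h'] Impl.prems
    by (simp add: h call_prog translateB_def run_matchE enc_nat_inj Let_def)
next
  case (Equiv \<phi> \<psi>)
  then obtain h' where h: "h = Suc h'" by (cases h) auto
  show ?case using Equiv.IH[of h'] Equiv.prems
    by (simp add: h call_prog translateB_def run_matchE enc_nat_inj Let_def)
next
  case (Ex y \<phi>)
  then obtain h' where h: "h = Suc h'" by (cases h) auto
  show ?case using Ex.IH[of h'] Ex.prems
    by (simp add: h call_prog translateB_def run_matchE enc_nat_inj Let_def)
next
  case (ExMod t p ys \<phi>)
  then obtain h' where h: "h = Suc h'" by (cases h) auto
  have len: "length ys \<le> N" "length (bits p) \<le> N"
    using ExMod.prems length_le_sum_nat_size[of ys] by (auto simp: nat_size_def)
  then have "length ys * (length (bits p) + 4) \<le> N * (N + 4)" by (intro mult_le_mono) auto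
  then have "length ys * (length (bits p) + 4) + length (bits p) + length ys < h'"
    using ExMod.prems len h by (simp add: algebra_simps)
  then show ?case using ExMod.IH[of h'] ExMod.prems
    by (simp add: h call_prog translateB_def run_matchE enc_nat_inj Let_def call_mod funpow_numerals)
next
  case (ExGe c ys \<phi>)
  then obtain h' where h: "h = Suc h'" by (cases h) auto
  have "length ys \<le> N" "length (bits c) \<le> N"
    using ExGe.prems length_le_sum_nat_size[of ys] by (auto simp: nat_size_def)
  then have "length ys + length (bits c) + 1 < h'" using ExGe.prems h by (simp add: algebra_simps)
  then show ?case using ExGe.IH[of h'] ExGe.prems
    by (simp add: h call_prog translateB_def run_matchE enc_nat_inj Let_def call_ge funpow_numerals)
next
  case (ExEq c ys \<phi>)
  then obtain h' where h: "h = Suc h'" by (cases h) auto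
  have "length ys \<le> N" "length (bits c) \<le> N"
    using ExEq.prems length_le_sum_nat_size[of ys] by (auto simp: nat_size_def)
  then have "length ys + length (bits c) + 1 < h'" "length ys + length (bits (Suc c)) + 1 < h'"
    "length (bits c) < h'"
    using ExEq.prems h length_bits_Suc[of c] by (simp_all add: algebra_simps)
  then show ?case using ExEq.IH[of h'] ExEq.prems
    by (simp add: h call_prog translateB_def run_matchE enc_nat_inj Let_def call_ge call_inc funpow_numerals)
qed

section \<open>The bounds\<close>

primrec leaves :: "tree \<Rightarrow> nat" where
  "leaves Leaf = 1"
| "leaves (Pair a b) = leaves a + leaves b"

text \<open>Each leaf doubles the successor of the accumulator.\<close>

lemma flatten_leaves: "Suc (flatten t m) = 2 ^ leaves t * Suc m"
  by (induction t arbitrary: m) (simp_all add: power_add mult.assoc del: mult_Suc_right, simp)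

lemma leaves_enc_nats: "sum_list (map leaves ts) < leaves (enc_list ts)"
  by (induction ts) auto

lemma leaves_node: "sum_list (map leaves ts) < leaves (node k ts)"
  using leaves_enc_nats[of ts] by (simp add: node_def)

lemma leaves_pos: "0 < leaves t"
  by (induction t) auto

text \<open>Each digit contributes at least one leaf, and the end of the digit list one
  more.\<close>

lemma less_power_leaves: "n < 2 ^ (leaves (enc_nat n) - 1)"
proof -
  have "length bs < leaves (enc_list (map enc_bool bs))" for bs
    by (induction bs) (auto simp: leaves_pos intro: le_less_trans[OF _ add_less_mono1, of _ 0])
  from this[of "bits n"] have "length (bits n) \<le> leaves (enc_nat n) - 1" by (simp add: enc_nat_def)
  then show ?thesis using less_power_bits[of n] power_increasing[of "length (bits n)" _ "2 :: nat"]
    by (meson less_le_trans one_le_numeral)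
qed

lemma var_below:
  assumes "leaves (enc_nat v) \<le> n"
  shows "v < 2 ^ n - 1"
proof -
  have "v < 2 ^ (n - 1)"
    using less_power_leaves[of v] assms power_increasing[of "leaves (enc_nat v) - 1" "n - 1" "2 :: nat"]
    by (meson diff_le_mono less_le_trans one_le_numeral)
  moreover have "2 ^ n = 2 * (2 :: nat) ^ (n - 1)"
    using assms leaves_pos[of "enc_nat v"] by (cases n) auto
  ultimately show ?thesis by linarith
qed

lemma tm_below_leaves: "leaves (enc_tm t) \<le> n \<Longrightarrow> tm_below (2 ^ n - 1) t"
proof (induction t)
  case (Var v)
  then show ?case using leaves_node[of "[enc_nat v]" 0] by (simp add: var_below del: One_nat_def)
next
  case (Add s t)
  then show ?case using leaves_node[of "[enc_tm s, enc_tm t]" 2] by simp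
next
  case (Mul a t)
  then show ?case using leaves_node[of "[enc_int a, enc_tm t]" 3] by simp
qed simp

lemma vars_below_leaves:
  assumes "leaves (enc_list (map enc_nat ys)) \<le> n"
  shows "\<forall>y\<in>set ys. y < 2 ^ n - 1"
proof
  fix y assume "y \<in> set ys"
  then have "leaves (enc_nat y) \<le> sum_list (map leaves (map enc_nat ys))"
    by (intro member_le_sum_list) auto
  then show "y < 2 ^ n - 1" using leaves_enc_nats[of "map enc_nat ys"] assms by (intro var_below) simp
qed

text \<open>The bound \<open>n\<close> stays fixed while the induction descends, because every
  component has fewer leaves than its node.\<close>

lemma fm_below_leaves: "leaves (enc_fm \<phi>) \<le> n \<Longrightarrow> fm_below (2 ^ n - 1) \<phi>"
proof (induction \<phi>)
  case (Less s t)
  then show ?case using leaves_node[of "[enc_tm s, enc_tm t]" 0] by (simp add: tm_below_leaves del: One_nat_def)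
next
  case (CongAt k s t)
  then show ?case using leaves_node[of "[enc_nat k, enc_tm s, enc_tm t]" 1]
    by (simp add: tm_below_leaves del: One_nat_def)
next
  case (Neg \<phi>)
  then show ?case using leaves_node[of "[enc_fm \<phi>]" 2] by simp
next
  case (Conj \<phi> \<psi>)
  then show ?case using leaves_node[of "[enc_fm \<phi>, enc_fm \<psi>]" 3] by simp
next
  case (Disj \<phi> \<psi>)
  then show ?case using leaves_node[of "[enc_fm \<phi>, enc_fm \<psi>]" 4] by simp
next
  case (Impl \<phi> \<psi>)
  then show ?case using leaves_node[of "[enc_fm \<phi>, enc_fm \<psi>]" 5] by simp
next
  case (Equiv \<phi> \<psi>)
  then show ?case using leaves_node[of "[enc_fm \<phi>, enc_fm \<psi>]" 6] by simp
next
  case (Ex y \<phi>)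
  then show ?case using leaves_node[of "[enc_nat y, enc_fm \<phi>]" 7] by (simp add: var_below del: One_nat_def)
next
  case (ExMod t p ys \<phi>)
  then show ?case
    using leaves_node[of "[enc_tm t, enc_nat p, enc_list (map enc_nat ys), enc_fm \<phi>]" 8]
      vars_below_leaves[of ys n] by (simp add: tm_below_leaves del: One_nat_def)
next
  case (ExGe c ys \<phi>)
  then show ?case
    using leaves_node[of "[enc_nat c, enc_list (map enc_nat ys), enc_fm \<phi>]" 9]
      vars_below_leaves[of ys n] by simp
next
  case (ExEq c ys \<phi>)
  then show ?case
    using leaves_node[of "[enc_nat c, enc_list (map enc_nat ys), enc_fm \<phi>]" 10]
      vars_below_leaves[of ys n] by simp
qed

section \<open>Total depth and double exponential time\<close>

definition translation :: "fm \<Rightarrow> fm" where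
  "translation \<phi> = translate_fm (flatten (enc_fm \<phi>) 0) \<phi>"

lemma equivalent_translation: "wf_fm \<phi> \<Longrightarrow> equivalent \<phi> (translation \<phi>)"
proof -
  assume "wf_fm \<phi>"
  moreover have "flatten (enc_fm \<phi>) 0 = 2 ^ leaves (enc_fm \<phi>) - 1"
    using flatten_leaves[of "enc_fm \<phi>" 0] by simp
  ultimately show ?thesis
    using fm_below_leaves[OF order_refl, of \<phi>] by (simp add: equivalent_def translation_def sat_translate_fm)
qed

text \<open>A common bound that, beyond one level for function 0, suffices both for
  \<open>call_translate\<close> and for walking through the encoded input, which has at most
  \<open>40 * N\<close> nodes.\<close>

definition depth :: "nat \<Rightarrow> nat" where
  "depth N = 10 + 50 * N + N * N"

lemma call_main: "call prog (depth (fm_size \<phi>)) 0 [enc_fm \<phi>] = Some (enc_fm (translation \<phi>))"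
proof -
  let ?N = "fm_size \<phi>"
  obtain h where h: "depth ?N = Suc h" by (cases "depth ?N") (auto simp: depth_def)
  then have "?N + ?N * (?N + 6) + 2 < h" "tree_size (enc_fm \<phi>) \<le> h"
    using tree_size_enc_fm[of \<phi>] by (auto simp: depth_def algebra_simps)
  then show ?thesis
    using call_translate[of \<phi> ?N h] call_flatten[of "enc_fm \<phi>" h 0]
    by (simp add: h call_prog translation_def)
qed

text \<open>By \<open>5 \<le> 2 ^ 3\<close> and \<open>3 \<le> 2 ^ 2\<close> the first factor adds 2
  to the inner exponent. Multiplying the factors adds the two inner powers, and a sum is at most
  twice the product, which makes the constant 3.\<close>

lemma double_exp_bound:
  fixes D h N :: nat
  shows "5 ^ (D ^ h) * (1 + 40 * N) \<le> 2 ^ (2 ^ (D * h + 40 * N + 3))"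
proof -
  have "D ^ h \<le> (2 ^ D) ^ h" by (intro power_mono) (simp_all add: less_imp_le)
  then have D: "D ^ h \<le> 2 ^ (D * h)" by (simp add: power_mult)
  have "(5 :: nat) ^ (D ^ h) \<le> 5 ^ (2 ^ (D * h))" using D by (rule power_increasing) simp
  also have "\<dots> \<le> (2 ^ 3) ^ (2 ^ (D * h))" by (rule power_mono) simp_all
  also have "\<dots> = 2 ^ (3 * 2 ^ (D * h))" by (simp only: power_mult)
  also have "\<dots> \<le> 2 ^ (2 ^ (D * h + 2))" by (intro power_increasing) simp_all
  finally have 1: "(5 :: nat) ^ (D ^ h) \<le> 2 ^ (2 ^ (D * h + 2))" .
  have "1 + 40 * N \<le> 2 ^ (40 * N)"
    by (simp only: Suc_eq_plus1_left[symmetric] Suc_le_eq less_exp)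
  also have "\<dots> \<le> 2 ^ (2 ^ (40 * N))" using less_exp[of "40 * N"] by (intro power_increasing) auto
  finally have 2: "1 + 40 * N \<le> 2 ^ (2 ^ (40 * N))" .
  have "(2 :: nat) ^ (D * h + 2) + 2 ^ (40 * N) \<le> 2 * (2 ^ (D * h + 2) * 2 ^ (40 * N))"
    by (rule add_le_twice_mult) auto
  also have "\<dots> = 2 ^ (D * h + 40 * N + 3)" by (simp add: power_add)
  finally have "(2 :: nat) ^ (2 ^ (D * h + 2) + 2 ^ (40 * N)) \<le> 2 ^ (2 ^ (D * h + 40 * N + 3))"
    by (rule power_increasing) simp
  then show ?thesis using mult_le_mono[OF 1 2] unfolding power_add[symmetric] by (rule order_trans[rotated])
qed

theorem theorem3p7:
  shows "\<exists>(P :: program) (r :: nat poly) (d :: nat poly).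
    \<forall>\<phi> \<in> FO_counting. \<exists>\<gamma> \<in> FO_unary_mod.
      (\<exists>n. computes P (enc_fm \<phi>) (enc_fm \<gamma>) n \<and> n \<le> 2 ^ (2 ^ poly r (fm_size \<phi>))) \<and>
      equivalent \<phi> \<gamma> \<and>
      Coeff \<gamma> \<subseteq> Coeff \<phi> \<and>
      Constants \<gamma> \<subseteq> Constants \<phi> \<and>
      Mod \<gamma> \<subseteq> Mod \<phi> \<and>
      qd \<gamma> \<le> poly d (fm_size \<phi>)"
proof -
  from call_time[of prog] obtain D where D: "\<And>h i vs v. call prog h i vs = Some v \<Longrightarrow>
      \<exists>n. eval prog vs (prog ! i) v n \<and> n \<le> 5 ^ (D ^ h) * env_size vs"
    by blast
  \<comment> \<open>The first part of \<open>?r\<close> is \<open>D\<close> times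
    \<open>depth\<close>, the second comes from \<open>double_exp_bound\<close>. As \<open>D\<close>
    belongs to \<open>prog\<close>, both polynomials are fixed before the formula.\<close>
  let ?r = "smult D [:10, 50, 1:] + [:3, 40:]" and ?d = "[:0, 3, 1:] :: nat poly"
  have r: "poly ?r N = D * depth N + 40 * N + 3" for N
    by (simp add: depth_def algebra_simps)
  have d: "poly ?d N = N * (N + 3)" for N
    by (simp add: algebra_simps)
  show ?thesis
  proof (rule exI[of _ prog], rule exI[of _ ?r], rule exI[of _ ?d], intro ballI bexI conjI)
    fix \<phi> assume "\<phi> \<in> FO_counting"
    then have wf: "wf_fm \<phi>" by (simp add: FO_counting_def)
    let ?N = "fm_size \<phi>"
    from D[OF call_main] obtain n where n: "eval prog [enc_fm \<phi>] (prog ! 0) (enc_fm (translation \<phi>)) n"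
      "n \<le> 5 ^ (D ^ depth ?N) * env_size [enc_fm \<phi>]" by blast
    have "env_size [enc_fm \<phi>] \<le> 1 + 40 * ?N" using tree_size_enc_fm[of \<phi>] by simp
    with n(2) have "n \<le> 5 ^ (D ^ depth ?N) * (1 + 40 * ?N)"
      by (meson mult_le_mono2 order_trans)
    also have "\<dots> \<le> 2 ^ (2 ^ poly ?r ?N)" unfolding r by (rule double_exp_bound)
    finally show "\<exists>n. computes prog (enc_fm \<phi>) (enc_fm (translation \<phi>)) n \<and> n \<le> 2 ^ (2 ^ poly ?r ?N)"
      using n(1) by (auto simp: computes_def prog_def)
    show "equivalent \<phi> (translation \<phi>)" using wf by (rule equivalent_translation)
    show "translation \<phi> \<in> FO_unary_mod" "Coeff (translation \<phi>) \<subseteq> Coeff \<phi>"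
      "Constants (translation \<phi>) \<subseteq> Constants \<phi>" "Mod (translation \<phi>) \<subseteq> Mod \<phi>"
      unfolding translation_def using wf by (rule parameters_translate_fm)+
    show "qd (translation \<phi>) \<le> poly ?d ?N"
      unfolding translation_def d by (rule qd_translate_fm) simp
  qed
qed

end
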